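(* The first Grigorchuk group $G_{012}$ satisfies $G_{012}\rightsquigarrow\mathbb F_3$, where $\mathbb F_3$ is the free group of rank $3$.
   Context: For finitely generated groups $G,H$, write $G\rightsquigarrow H$ ("$G$ preforms $H$") if there exist a finite generating set $T$ of $H$ and a sequence $S_1,S_2,\dots$ of finite generating sets of $G$, with bijections $S_n\to T$, such that for every $R\in\mathbb N$ and all $n$ large enough the balls of radius $R$ around the identity in the Cayley graphs of $(G,S_n)$ and $(H,T)$ are isomorphic as rooted graphs with edges labelled by generators, labels being identified via $S_n\to T$. The first Grigorchuk group $G_{012}$ is the group of transformations of $\{0,1\}^\infty$ (acting on the right) generated by $a,b,c,d$, defined recursively for $\omega\in\{0,1\}^\infty$ by $(0\omega)a=1\omega$, $(1\omega)a=0\omega$; $(0\omega)b=0(\omega a)$, $(1\omega)b=1(\omega c)$; $(0\omega)c=0(\omega a)$, $(1\omega)c=1(\omega d)$; $(0\omega)d=0\omega$, $(1\omega)d=1(\omega b)$. *)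

theory Defs
  imports "HOL-Algebra.Generated_Groups" "HOL-Library.Stream" "HOL-Library.Z2"
begin

section \<open>Rooted edge-labelled graphs and Cayley graphs\<close>

text \<open>An edge is a triple (source, label, target).\<close>

record ('v, 'l) rlgraph =
  root :: 'v
  vertices :: "'v set"
  edges :: "('v \<times> 'l \<times> 'v) set"

text \<open>The graph distance ignores the orientation of edges.\<close>

primrec ball_vertices :: "('v, 'l) rlgraph \<Rightarrow> nat \<Rightarrow> 'v set" where
  "ball_vertices \<Gamma> 0 = {root \<Gamma>}"
| "ball_vertices \<Gamma> (Suc R) = ball_vertices \<Gamma> R \<union>
     {y. \<exists>x\<in>ball_vertices \<Gamma> R. \<exists>l. (x, l, y) \<in> edges \<Gamma> \<or> (y, l, x) \<in> edges \<Gamma>}"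

definition graph_ball :: "('v, 'l) rlgraph \<Rightarrow> nat \<Rightarrow> ('v, 'l) rlgraph" where
  "graph_ball \<Gamma> R =
     \<lparr>root = root \<Gamma>,
      vertices = ball_vertices \<Gamma> R,
      edges = {(x, l, y). (x, l, y) \<in> edges \<Gamma> \<and> x \<in> ball_vertices \<Gamma> R \<and> y \<in> ball_vertices \<Gamma> R}\<rparr>"

text \<open>
  Isomorphism of rooted labelled graphs, where a label \<open>l\<close> of \<open>\<Gamma>\<close> is identified with the
  label \<open>\<beta> l\<close> of \<open>\<Delta>\<close>; \<open>\<beta>\<close> is meant to be injective on the labels of \<open>\<Gamma>\<close>.
\<close>

definition rooted_labelled_iso ::
    "('l \<Rightarrow> 'm) \<Rightarrow> ('v, 'l) rlgraph \<Rightarrow> ('w, 'm) rlgraph \<Rightarrow> bool" where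
  "rooted_labelled_iso \<beta> \<Gamma> \<Delta> \<longleftrightarrow>
     (\<exists>\<phi>. bij_betw \<phi> (vertices \<Gamma>) (vertices \<Delta>) \<and> \<phi> (root \<Gamma>) = root \<Delta> \<and>
          (\<lambda>(x, l, y). (\<phi> x, \<beta> l, \<phi> y)) ` edges \<Gamma> = edges \<Delta>)"

definition cayley_graph :: "('a, 'm) monoid_scheme \<Rightarrow> 'a set \<Rightarrow> ('a, 'a) rlgraph" where
  "cayley_graph G S =
     \<lparr>root = \<one>\<^bsub>G\<^esub>,
      vertices = carrier G,
      edges = {(g, s, g \<otimes>\<^bsub>G\<^esub> s) | g s. g \<in> carrier G \<and> s \<in> S}\<rparr>"

definition finite_generating_set :: "('a, 'm) monoid_scheme \<Rightarrow> 'a set \<Rightarrow> bool" where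
  "finite_generating_set G S \<longleftrightarrow> finite S \<and> S \<subseteq> carrier G \<and> generate G S = carrier G"

definition preforms :: "('a, 'm) monoid_scheme \<Rightarrow> ('b, 'n) monoid_scheme \<Rightarrow> bool" where
  "preforms G H \<longleftrightarrow>
     (\<exists>T S \<beta>. finite_generating_set H T \<and>
        (\<forall>n::nat. finite_generating_set G (S n) \<and> bij_betw (\<beta> n) (S n) T) \<and>
        (\<forall>R. \<forall>\<^sub>F n in sequentially.
           rooted_labelled_iso (\<beta> n) (graph_ball (cayley_graph G (S n)) R)
             (graph_ball (cayley_graph H T) R)))"


section \<open>The first Grigorchuk group\<close>

definition grig_a :: "bit stream \<Rightarrow> bit stream" where
  "grig_a x = (shd x + 1) ## stl x"

text \<open>
  The mutual recursion of \<open>b\<close>, \<open>c\<close>, \<open>d\<close> is turned into a single corecursive function with the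
  letter as a parameter; the defining equations are recovered in \<open>grig_rec\<close> below.
\<close>

datatype grig_letter = Letter_b | Letter_c | Letter_d

primrec grig_zero :: "grig_letter \<Rightarrow> bit stream \<Rightarrow> bit stream" where
  "grig_zero Letter_b = grig_a"
| "grig_zero Letter_c = grig_a"
| "grig_zero Letter_d = id"

primrec grig_one :: "grig_letter \<Rightarrow> grig_letter" where
  "grig_one Letter_b = Letter_c"
| "grig_one Letter_c = Letter_d"
| "grig_one Letter_d = Letter_b"

primcorec grig :: "grig_letter \<Rightarrow> bit stream \<Rightarrow> bit stream" where
  "grig l x = shd x ## (if shd x = 0 then grig_zero l (stl x) else grig (grig_one l) (stl x))"

definition grig_b :: "bit stream \<Rightarrow> bit stream" where "grig_b = grig Letter_b"
definition grig_c :: "bit stream \<Rightarrow> bit stream" where "grig_c = grig Letter_c"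
definition grig_d :: "bit stream \<Rightarrow> bit stream" where "grig_d = grig Letter_d"

lemma grig_rec:
  "grig_a (0 ## w) = 1 ## w"           "grig_a (1 ## w) = 0 ## w"
  "grig_b (0 ## w) = 0 ## grig_a w"    "grig_b (1 ## w) = 1 ## grig_c w"
  "grig_c (0 ## w) = 0 ## grig_a w"    "grig_c (1 ## w) = 1 ## grig_d w"
  "grig_d (0 ## w) = 0 ## w"           "grig_d (1 ## w) = 1 ## grig_b w"
  by (simp_all add: grig_a_def grig_b_def grig_c_def grig_d_def grig.code[of _ "_ ## _"])

lemma grig_a_invol: "grig_a (grig_a x) = x"
  by (cases x) (simp add: grig_a_def add.assoc)

lemma grig_invol: "grig l (grig l x) = x"
proof (coinduction arbitrary: l x rule: stream.coinduct_strong)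
  case Eq_stream
  then show ?case
    by (cases l) (auto simp: grig_a_invol)
qed

lemma bij_grig: "bij grig_a" "bij grig_b" "bij grig_c" "bij grig_d"
  unfolding grig_b_def grig_c_def grig_d_def
  by (rule involuntory_imp_bij; simp add: grig_a_invol grig_invol)+

text \<open>Transformations act on the right: in a product, the left factor is applied first.\<close>

definition right_bij_group :: "('a \<Rightarrow> 'a) monoid" where
  "right_bij_group = \<lparr>carrier = {f. bij f}, mult = (\<lambda>f g. g \<circ> f), one = id\<rparr>"

lemma group_right_bij_group: "group (right_bij_group :: ('a \<Rightarrow> 'a) monoid)"
proof (rule groupI)
  fix f :: "'a \<Rightarrow> 'a"
  assume "f \<in> carrier right_bij_group"
  then show "\<exists>g\<in>carrier right_bij_group. g \<otimes>\<^bsub>right_bij_group\<^esub> f = \<one>\<^bsub>right_bij_group\<^esub>"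
    by (intro bexI[of _ "inv_into UNIV f"])
       (auto simp: right_bij_group_def bij_imp_bij_inv bij_is_surj surj_iff[THEN iffD1])
qed (auto simp: right_bij_group_def bij_comp o_assoc)

definition grigorchuk_group :: "(bit stream \<Rightarrow> bit stream) monoid" where
  "grigorchuk_group = subgroup_generated right_bij_group {grig_a, grig_b, grig_c, grig_d}"

lemma group_grigorchuk_group: "group grigorchuk_group"
  unfolding grigorchuk_group_def
  by (rule group.group_subgroup_generated[OF group_right_bij_group])

lemma carrier_grigorchuk_group:
  "carrier grigorchuk_group = generate right_bij_group {grig_a, grig_b, grig_c, grig_d}"
proof -
  have "carrier right_bij_group \<inter> {grig_a, grig_b, grig_c, grig_d} = {grig_a, grig_b, grig_c, grig_d}"
    using bij_grig by (auto simp: right_bij_group_def)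
  then show ?thesis
    by (simp add: grigorchuk_group_def carrier_subgroup_generated)
qed


section \<open>Free groups\<close>

text \<open>
  The free group on \<open>X\<close> consists of the reduced words in the letters \<open>(x, True)\<close>, standing for
  \<open>x\<close>, and \<open>(x, False)\<close>, standing for the inverse of \<open>x\<close>, multiplied by concatenation followed
  by free reduction.
\<close>

definition inv_letter :: "'a \<times> bool \<Rightarrow> 'a \<times> bool" where
  "inv_letter l = (fst l, \<not> snd l)"

fun reduced :: "('a \<times> bool) list \<Rightarrow> bool" where
  "reduced (l # m # w) \<longleftrightarrow> m \<noteq> inv_letter l \<and> reduced (m # w)"
| "reduced _ \<longleftrightarrow> True"

fun cons_reduce :: "'a \<times> bool \<Rightarrow> ('a \<times> bool) list \<Rightarrow> ('a \<times> bool) list" where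
  "cons_reduce l [] = [l]"
| "cons_reduce l (m # w) = (if m = inv_letter l then w else l # m # w)"

definition free_group :: "'a set \<Rightarrow> ('a \<times> bool) list monoid" where
  "free_group X =
     \<lparr>carrier = {w. reduced w \<and> set w \<subseteq> X \<times> UNIV},
      mult = (\<lambda>u v. foldr cons_reduce u v),
      one = []\<rparr>"

lemma inv_letter_invol [simp]: "inv_letter (inv_letter l) = l"
  by (simp add: inv_letter_def)

lemma inv_letter_neq [simp]: "inv_letter l \<noteq> l" "l \<noteq> inv_letter l"
  by (cases l; simp add: inv_letter_def)+

lemma reduced_Cons: "reduced (l # w) \<longleftrightarrow> reduced w \<and> (w \<noteq> [] \<longrightarrow> hd w \<noteq> inv_letter l)"
  by (cases w) auto

lemma reduced_cons_reduce: "reduced w \<Longrightarrow> reduced (cons_reduce l w)"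
  by (cases w) (auto simp: reduced_Cons)

lemma set_cons_reduce: "set (cons_reduce l w) \<subseteq> insert l (set w)"
  by (cases w) auto

lemma cons_reduce_eq_Cons: "reduced (l # w) \<Longrightarrow> cons_reduce l w = l # w"
  by (cases w) auto

lemma cons_reduce_inv: "reduced w \<Longrightarrow> cons_reduce l (cons_reduce (inv_letter l) w) = w"
  by (cases w) (auto simp: cons_reduce_eq_Cons)

lemma reduced_foldr: "reduced v \<Longrightarrow> reduced (foldr cons_reduce u v)"
  by (induction u) (auto intro: reduced_cons_reduce)

lemma set_foldr_cons_reduce: "set (foldr cons_reduce u v) \<subseteq> set u \<union> set v"
  by (induction u) (use set_cons_reduce in fastforce)+

lemma foldr_cons_reduce:
  assumes "reduced w" shows "foldr cons_reduce (cons_reduce l v) w = cons_reduce l (foldr cons_reduce v w)"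
proof (cases v)
  case (Cons m v')
  then show ?thesis
    using cons_reduce_inv[OF reduced_foldr[OF assms, of v'], of l] by auto
qed simp

lemma foldr_cons_reduce_assoc:
  assumes "reduced w"
  shows "foldr cons_reduce (foldr cons_reduce u v) w = foldr cons_reduce u (foldr cons_reduce v w)"
  by (induction u) (simp_all add: foldr_cons_reduce assms)

lemma foldr_cons_reduce_Nil: "reduced w \<Longrightarrow> foldr cons_reduce w [] = w"
  by (induction w) (auto simp: reduced_Cons intro: cons_reduce_eq_Cons[unfolded reduced_Cons])

lemma foldr_cons_reduce_inv:
  "reduced v \<Longrightarrow> foldr cons_reduce (rev (map inv_letter w)) (foldr cons_reduce w v) = v"
proof (induction w)
  case (Cons l w)
  then show ?case
    using cons_reduce_inv[of "foldr cons_reduce w v" "inv_letter l"] by (simp add: reduced_foldr)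
qed simp

theorem group_free_group: "group (free_group X)"
proof (rule groupI)
  fix u v assume "u \<in> carrier (free_group X)" "v \<in> carrier (free_group X)"
  then show "u \<otimes>\<^bsub>free_group X\<^esub> v \<in> carrier (free_group X)"
    using set_foldr_cons_reduce[of u v] by (auto simp: free_group_def reduced_foldr)
next
  fix w assume w: "w \<in> carrier (free_group X)"
  let ?v = "foldr cons_reduce (rev (map inv_letter w)) []"
  have "set ?v \<subseteq> X \<times> UNIV"
    using w set_foldr_cons_reduce[of "rev (map inv_letter w)" "[]"]
    by (fastforce simp: free_group_def inv_letter_def)
  moreover have "foldr cons_reduce ?v w = []"
    using w foldr_cons_reduce_inv[of "[]" w]
    by (simp add: free_group_def foldr_cons_reduce_assoc foldr_cons_reduce_Nil)
  ultimately show "\<exists>v\<in>carrier (free_group X). v \<otimes>\<^bsub>free_group X\<^esub> w = \<one>\<^bsub>free_group X\<^esub>"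
    by (intro bexI[of _ ?v]) (auto simp: free_group_def reduced_foldr)
qed (auto simp: free_group_def foldr_cons_reduce_assoc)

definition eval_word :: "('b, 'm) monoid_scheme \<Rightarrow> ('a \<Rightarrow> 'b) \<Rightarrow> ('a \<times> bool) list \<Rightarrow> 'b" where
  "eval_word K f w =
     foldr (\<lambda>(x, e) g. (if e then f x else inv\<^bsub>K\<^esub> f x) \<otimes>\<^bsub>K\<^esub> g) w \<one>\<^bsub>K\<^esub>"

theorem free_group_universal:
  assumes "group K" and f: "f \<in> X \<rightarrow> carrier K"
  shows "eval_word K f \<in> hom (free_group X) K"
    and "\<And>x. x \<in> X \<Longrightarrow> eval_word K f [(x, True)] = f x"
    and "\<And>h w. h \<in> hom (free_group X) K \<Longrightarrow> (\<And>x. x \<in> X \<Longrightarrow> h [(x, True)] = f x) \<Longrightarrow>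
           w \<in> carrier (free_group X) \<Longrightarrow> h w = eval_word K f w"
proof -
  interpret K: group K by fact
  interpret F: group "free_group X" by (rule group_free_group)
  have closed: "eval_word K f w \<in> carrier K" if "set w \<subseteq> X \<times> UNIV" for w
    using that f by (induction w) (auto simp: eval_word_def Pi_iff)
  have step: "eval_word K f (cons_reduce l w) = eval_word K f [l] \<otimes>\<^bsub>K\<^esub> eval_word K f w"
    if "l \<in> X \<times> UNIV" "set w \<subseteq> X \<times> UNIV" for l w
  proof (cases w)
    case Nil
    with that f show ?thesis by (auto simp: eval_word_def Pi_iff)
  next
    case (Cons m w')
    then have "eval_word K f w' \<in> carrier K" using that closed by auto
    then show ?thesis using that f Cons
      by (auto simp: eval_word_def inv_letter_def K.m_assoc[symmetric] Pi_iff)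
  qed
  have mult: "eval_word K f (foldr cons_reduce u v) = eval_word K f u \<otimes>\<^bsub>K\<^esub> eval_word K f v"
    if "set u \<subseteq> X \<times> UNIV" "set v \<subseteq> X \<times> UNIV" for u v
    using that(1)
  proof (induction u)
    case Nil
    then show ?case using closed[OF that(2)] by (simp add: eval_word_def)
  next
    case (Cons l u)
    have s: "set (foldr cons_reduce u v) \<subseteq> X \<times> UNIV"
      using set_foldr_cons_reduce[of u v] Cons.prems that(2) by auto
    have "eval_word K f (l # u) = eval_word K f [l] \<otimes>\<^bsub>K\<^esub> eval_word K f u"
      using Cons.prems f closed[of u] by (auto simp: eval_word_def Pi_iff)
    moreover have "eval_word K f [l] \<in> carrier K" "eval_word K f u \<in> carrier K"
      using Cons.prems by (auto intro!: closed)
    ultimately show ?case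
      using Cons step[OF _ s, of l] closed[OF that(2)] by (simp add: K.m_assoc)
  qed
  show "eval_word K f \<in> hom (free_group X) K"
    by (rule homI) (auto simp: free_group_def intro!: closed mult)
  show ev: "eval_word K f [(x, True)] = f x" if "x \<in> X" for x
    using that f by (auto simp: eval_word_def Pi_iff)
  fix h w
  assume h: "h \<in> hom (free_group X) K" and hf: "\<And>x. x \<in> X \<Longrightarrow> h [(x, True)] = f x"
    and w: "w \<in> carrier (free_group X)"
  interpret h: group_hom "free_group X" K h
    by unfold_locales (rule h)
  have inv1: "inv\<^bsub>free_group X\<^esub> [(x, True)] = [(x, False)]" if "x \<in> X" for x
    by (rule F.inv_equality) (use that in \<open>auto simp: free_group_def inv_letter_def\<close>)
  have letter: "h [(x, e)] = (if e then f x else inv\<^bsub>K\<^esub> f x)" if "x \<in> X" for x e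
  proof (cases e)
    case False
    have "[(x, True)] \<in> carrier (free_group X)" using that by (simp add: free_group_def)
    then have "h (inv\<^bsub>free_group X\<^esub> [(x, True)]) = inv\<^bsub>K\<^esub> (h [(x, True)])" by (rule h.hom_inv)
    with False show ?thesis using inv1[OF that] hf[OF that] by simp
  qed (use hf[OF that] in simp)
  from w show "h w = eval_word K f w"
  proof (induction w)
    case Nil
    then show ?case using h.hom_one by (simp add: eval_word_def free_group_def)
  next
    case (Cons l w)
    have "l # w = [l] \<otimes>\<^bsub>free_group X\<^esub> w"
      using Cons.prems by (simp add: free_group_def cons_reduce_eq_Cons)
    moreover have cw: "[l] \<in> carrier (free_group X)" "w \<in> carrier (free_group X)"
      using Cons.prems by (auto simp: free_group_def reduced_Cons)
    ultimately have "h (l # w) = h [l] \<otimes>\<^bsub>K\<^esub> h w" by simp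
    then show ?case using Cons.IH cw letter by (auto simp: eval_word_def free_group_def)
  qed
qed

end

theory Submission
  imports Defs
begin

text \<open>
  Let \<open>K\<close> be the normal closure of \<open>t = (ab)\<^sup>2\<close>; a copy of \<open>K\<close> acting below any vertex again lies in \<open>K\<close>.
  Fix \<open>n\<close>. The generators \<open>a, b, c\<close> are perturbed by elements of \<open>K\<close> acting below the vertices
  \<open>p0\<^sup>m\<close> with \<open>p\<close> of length \<open>N\<close>. Since \<open>K\<close> can move any single point while fixing a given finite set
  of others, the images of one point under the reduced words of length at most \<open>n\<close> can be made
  pairwise distinct, one word at a time, so the perturbed triple satisfies no relation that is
  visible in the ball.

  To see that the perturbed triple still generates, let \<open>u\<close> and \<open>v\<close> be the two ends of the Schreier
  graph of level \<open>N\<close>, which is a line; there \<open>b\<close> and \<open>c\<close> are left unperturbed, and a correction of \<open>a\<close>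
  at \<open>u\<close> makes the walk along the line from \<open>u\<close> to \<open>v\<close> act trivially below. So the sections at \<open>u\<close> of
  the group \<open>H\<close> generated by the triple are all of \<open>G\<close>. For fixed words in the generators the effect
  of the perturbation is confined, when \<open>m\<close> is large, to points with a long block of zeros, and a
  commutator with a conjugate that destroys this block is an element of \<open>H\<close> supported below \<open>u\<close>.
  Such elements form a normal subgroup of \<open>G\<close>, hence contain a copy of \<open>K\<close> at a vertex of bounded
  depth below \<open>u\<close>, hence (conjugating in \<open>H\<close>) at all vertices of that level; so \<open>H\<close> contains the
  perturbations, and \<open>a, b, c\<close>.
\<close>

section \<open>The Grigorchuk group and its branching subgroup\<close>

type_synonym bits = "bit stream"

abbreviation finv :: "('a \<Rightarrow> 'b) \<Rightarrow> 'b \<Rightarrow> 'a" where "finv \<equiv> inv_into UNIV"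

lemma grig_letters [simp]: "grig Letter_b = grig_b" "grig Letter_c = grig_c" "grig Letter_d = grig_d"
  by (simp_all flip: grig_b_def grig_c_def grig_d_def)

lemma grig_involutions [simp]:
  "grig_a (grig_a x) = x" "grig_b (grig_b x) = x" "grig_c (grig_c x) = x" "grig_d (grig_d x) = x"
  "grig l (grig l x) = x"
  by (simp_all add: grig_a_invol grig_b_def grig_c_def grig_d_def grig_invol del: grig_letters)

text \<open>Together with the identity, \<open>b\<close>, \<open>c\<close>, \<open>d\<close> form a
  Klein four-group. The value at two equal letters is a filler.\<close>

definition third :: "grig_letter \<Rightarrow> grig_letter \<Rightarrow> grig_letter" where
  "third l l' = (case (l, l') of
     (Letter_b, Letter_c) \<Rightarrow> Letter_d | (Letter_c, Letter_b) \<Rightarrow> Letter_d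
   | (Letter_b, Letter_d) \<Rightarrow> Letter_c | (Letter_d, Letter_b) \<Rightarrow> Letter_c
   | _ \<Rightarrow> Letter_b)"

text \<open>The first digit is kept. Below \<open>0\<close> the sections \<open>a\<close>,
  \<open>a\<close>, \<open>id\<close> obey the same multiplication rule, and below \<open>1\<close>
  the pair of letters is rotated and still distinct, so coinduction applies.\<close>

lemma grig_grig_third: "l \<noteq> l' \<Longrightarrow> grig l (grig l' x) = grig (third l l') x"
proof (coinduction arbitrary: l l' x rule: stream.coinduct_strong)
  case Eq_stream
  then show ?case
    by (cases l; cases l'; simp add: third_def grig_a_invol del: grig_letters)
       (metis grig_letter.simps)+
qed

lemma grig_b_c: "grig_b (grig_c x) = grig_d x"
  and grig_c_b: "grig_c (grig_b x) = grig_d x"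
  using grig_grig_third[of Letter_b Letter_c x] grig_grig_third[of Letter_c Letter_b x]
  by (simp_all add: third_def)

lemma grig_grig:
  "grig_b (grig_c x) = grig_d x" "grig_c (grig_b x) = grig_d x" "grig_d (grig_b x) = grig_c x"
  "grig_b (grig_d x) = grig_c x" "grig_c (grig_d x) = grig_b x" "grig_d (grig_c x) = grig_b x"
  by (metis grig_b_c grig_c_b grig_involutions)+

lemma grig_Cons:
  "grig_a (x ## w) = (x + 1) ## w"
  "grig l (0 ## w) = 0 ## grig_zero l w"
  "grig l (1 ## w) = 1 ## grig (grig_one l) w"
  by (simp_all add: grig_a_def grig.code[of _ "_ ## _"] del: grig_letters)

lemma bij_grig_a: "bij grig_a" and bij_grig_l: "bij (grig l)"
  by (rule involuntory_imp_bij; simp)+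

lemma stream_bit_cases [case_names 0 1]:
  fixes x :: bits
  obtains w where "x = 0 ## w" | w where "x = 1 ## w"
  by (metis bit_not_zero_iff stream.collapse)

text \<open>The generators are involutions, so the monoid they generate is already the
  group.\<close>

inductive_set grigG :: "(bits \<Rightarrow> bits) set" where
  grigG_id: "id \<in> grigG"
| grigG_a: "g \<in> grigG \<Longrightarrow> grig_a \<circ> g \<in> grigG"
| grigG_l: "g \<in> grigG \<Longrightarrow> grig l \<circ> g \<in> grigG"

lemma grigG_comp: "f \<in> grigG \<Longrightarrow> g \<in> grigG \<Longrightarrow> f \<circ> g \<in> grigG"
  by (induction rule: grigG.induct) (auto simp: comp_assoc intro: grigG.intros)

lemma grigG_generators: "grig_a \<in> grigG" "grig l \<in> grigG" "grig_b \<in> grigG" "grig_c \<in> grigG" "grig_d \<in> grigG"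
  using grigG_a[OF grigG_id] grigG_l[OF grigG_id] grigG_l[OF grigG_id, of Letter_b]
    grigG_l[OF grigG_id, of Letter_c] grigG_l[OF grigG_id, of Letter_d] by simp_all

lemma bij_grigG: "g \<in> grigG \<Longrightarrow> bij g"
  by (induction rule: grigG.induct) (blast intro: bij_id bij_comp bij_grig_a bij_grig_l)+

lemma inv_grig: "finv grig_a = grig_a" "finv (grig l) = grig l"
  by (rule inv_equality; simp)+

lemma inv_grigG: "g \<in> grigG \<Longrightarrow> finv g \<in> grigG"
proof (induction rule: grigG.induct)
  case (grigG_a g)
  then show "finv (grig_a \<circ> g) \<in> grigG"
    by (simp add: o_inv_distrib bij_grig_a bij_grigG inv_grig grigG_comp grigG_generators)
next
  case (grigG_l g l)
  then show "finv (grig l \<circ> g) \<in> grigG"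
    by (simp add: o_inv_distrib bij_grig_l bij_grigG inv_grig grigG_comp grigG_generators del: grig_letters)
next
  case grigG_id
  show "finv id \<in> grigG" by (simp add: grigG.grigG_id)
qed

section \<open>Maps supported below one vertex of the binary tree\<close>

primrec place :: "bit list \<Rightarrow> (bits \<Rightarrow> bits) \<Rightarrow> bits \<Rightarrow> bits" where
  "place [] k = k"
| "place (i # p) k = (\<lambda>\<xi>. if shd \<xi> = i then i ## place p k (stl \<xi>) else \<xi>)"

lemma place_shift [simp]: "place p k (p @- \<zeta>) = p @- k \<zeta>"
  by (induction p) auto

lemma place_outside: "stake (length p) \<xi> \<noteq> p \<Longrightarrow> place p k \<xi> = \<xi>"
  by (induction p arbitrary: \<xi>) auto

lemma place_append: "place (p @ q) k = place p (place q k)"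
  by (induction p) auto

lemma place_id [simp]: "place p id = id"
  by (induction p) (auto simp: fun_eq_iff)

lemma place_comp: "place p (f \<circ> g) = place p f \<circ> place p g"
  by (induction p) (auto simp: fun_eq_iff)

lemma stake_place: "n \<le> length p \<Longrightarrow> stake n (place p k \<xi>) = stake n \<xi>"
proof (induction p arbitrary: n \<xi>)
  case (Cons i p)
  then show ?case by (cases n) auto
qed simp

lemma vertex_cases:
  fixes \<xi> :: "'a stream"
  obtains (inside) \<zeta> where "\<xi> = p @- \<zeta>" | (outside) "stake (length p) \<xi> \<noteq> p"
  by (metis stake_sdrop)

lemma fun_eq_by_vertex:
  assumes "\<And>\<zeta>. f (p @- \<zeta>) = g (p @- \<zeta>)" "\<And>\<xi>. stake (length p) \<xi> \<noteq> p \<Longrightarrow> f \<xi> = g \<xi>"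
  shows "f = g"
  using assms by (metis ext vertex_cases)

lemma inv_place:
  assumes "bij k" shows "finv (place p k) = place p (finv k)" "bij (place p k)"
proof -
  have 1: "place p k \<circ> place p (finv k) = id" "place p (finv k) \<circ> place p k = id"
    using assms by (simp_all flip: place_comp add: bij_is_inj bij_is_surj surj_iff[THEN iffD1])
  then show "finv (place p k) = place p (finv k)" by (metis inv_unique_comp)
  show "bij (place p k)" using 1 by (metis o_bij)
qed

section \<open>The branching subgroup\<close>

definition grig_t :: "bits \<Rightarrow> bits" where "grig_t = grig_a \<circ> grig_b \<circ> grig_a \<circ> grig_b"

text \<open>The normal closure of \<open>(ab)\<^sup>2\<close>; conjugation by the generators suffices.\<close>

inductive_set grigK :: "(bits \<Rightarrow> bits) set" where
  grigK_id: "id \<in> grigK"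
| grigK_grig_t: "grig_t \<in> grigK"
| grigK_comp: "f \<in> grigK \<Longrightarrow> g \<in> grigK \<Longrightarrow> f \<circ> g \<in> grigK"
| grigK_conj_a: "k \<in> grigK \<Longrightarrow> grig_a \<circ> k \<circ> grig_a \<in> grigK"
| grigK_conj_l: "k \<in> grigK \<Longrightarrow> grig l \<circ> k \<circ> grig l \<in> grigK"

lemma grig_t_grigG: "grig_t \<in> grigG"
  unfolding grig_t_def by (intro grigG_comp grigG_generators)

lemma grigK_grigG: "k \<in> grigK \<Longrightarrow> k \<in> grigG"
  by (induction rule: grigK.induct) (blast intro: grigG_id grigG_comp grigG_generators grig_t_grigG)+

lemma grigK_conj: "g \<in> grigG \<Longrightarrow> k \<in> grigK \<Longrightarrow> finv g \<circ> k \<circ> g \<in> grigK"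
proof (induction arbitrary: k rule: grigG.induct)
  case (grigG_a g)
  have "finv g \<circ> (grig_a \<circ> k \<circ> grig_a) \<circ> g \<in> grigK"
    by (rule grigG_a.IH[OF grigK_conj_a[OF grigG_a.prems]])
  then show "finv (grig_a \<circ> g) \<circ> k \<circ> (grig_a \<circ> g) \<in> grigK"
    by (simp add: o_inv_distrib bij_grig_a bij_grigG grigG_a inv_grig comp_assoc)
next
  case (grigG_l g l)
  have "finv g \<circ> (grig l \<circ> k \<circ> grig l) \<circ> g \<in> grigK"
    by (rule grigG_l.IH[OF grigK_conj_l[OF grigG_l.prems]])
  then show "finv (grig l \<circ> g) \<circ> k \<circ> (grig l \<circ> g) \<in> grigK"
    by (simp add: o_inv_distrib bij_grig_l bij_grigG grigG_l inv_grig comp_assoc del: grig_letters)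
qed simp

lemma grig_t_inv: "finv grig_t = grig_b \<circ> grig_a \<circ> grig_b \<circ> grig_a"
  by (rule inv_equality) (simp_all add: grig_t_def)

text \<open>No rule of \<open>grigK\<close> mentions inverses: they come from the fact that
  \<open>t\<close> conjugated by \<open>b\<close> is the inverse of \<open>t\<close>.\<close>

lemma inv_grigK: "k \<in> grigK \<Longrightarrow> finv k \<in> grigK"
proof (induction rule: grigK.induct)
  case grigK_grig_t
  have "finv grig_t = grig Letter_b \<circ> grig_t \<circ> grig Letter_b"
    by (simp add: grig_t_inv fun_eq_iff) (simp add: grig_t_def)
  then show ?case by (metis grigK.grigK_grig_t grigK_conj_l)
next
  case (grigK_comp f g)
  then show "finv (f \<circ> g) \<in> grigK" by (simp add: o_inv_distrib bij_grigG grigK_grigG grigK.grigK_comp)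
next
  case (grigK_conj_a k)
  then show "finv (grig_a \<circ> k \<circ> grig_a) \<in> grigK" by (simp add: o_inv_distrib bij_comp bij_grigG grigK_grigG bij_grig_a inv_grig grigK.grigK_conj_a flip: comp_assoc)
next
  case (grigK_conj_l k l)
  then show "finv (grig l \<circ> k \<circ> grig l) \<in> grigK" by (simp add: o_inv_distrib bij_comp bij_grigG grigK_grigG bij_grig_l inv_grig grigK.grigK_conj_l
      flip: comp_assoc del: grig_letters)
next
  case grigK_id
  show "finv id \<in> grigK" by (simp add: grigK.grigK_id)
qed

lemma grig_one_surj: "\<exists>l'. grig_one l' = l"
  by (cases l) (metis grig_one.simps)+

lemma place_0_grigK: "k \<in> grigK \<Longrightarrow> place [0] k \<in> grigK"
proof (induction rule: grigK.induct)
  case grigK_grig_t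
  \<comment> \<open>\<open>(bada)\<^sup>2 = baba \<cdot> (ad) baba (ad)\<^sup>-\<^sup>1\<close>, which acts as \<open>(ab)\<^sup>2\<close> below \<open>0\<close> and trivially below \<open>1\<close>.\<close>
  have i: "finv grig_t \<in> grigK" by (intro inv_grigK grigK.grigK_grig_t)
  have "place [0] grig_t = finv grig_t \<circ> (grig_a \<circ> (grig Letter_d \<circ> finv grig_t \<circ> grig Letter_d) \<circ> grig_a)" (is "_ = ?g")
  proof (rule fun_eq_by_vertex[of _ "[0]"])
    fix \<zeta> show "place [0] grig_t ([0] @- \<zeta>) = ?g ([0] @- \<zeta>)"
      by (simp add: grig_t_inv grig_rec) (simp add: grig_t_def grig_grig)
    fix \<xi> :: bits assume "stake (length [0::bit]) \<xi> \<noteq> [0]"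
    then show "place [0] grig_t \<xi> = ?g \<xi>"
      by (cases \<xi> rule: stream_bit_cases) (simp_all add: grig_t_inv grig_rec)
  qed
  with i show ?case by (metis grigK.grigK_comp grigK.grigK_conj_a grigK.grigK_conj_l)
next
  case (grigK_comp f g)
  then show ?case by (simp only: place_comp grigK.grigK_comp)
next
  case (grigK_conj_a k)
  \<comment> \<open>\<open>b\<close> keeps the vertex \<open>0\<close> and acts as \<open>a\<close>
    below it.\<close>
  have "place [0] (grig_a \<circ> k \<circ> grig_a) = grig Letter_b \<circ> place [0] k \<circ> grig Letter_b"
  proof
    fix \<xi> :: bits
    show "place [0] (grig_a \<circ> k \<circ> grig_a) \<xi> = (grig Letter_b \<circ> place [0] k \<circ> grig Letter_b) \<xi>"
      by (cases \<xi> rule: stream_bit_cases) (simp_all add: grig_rec)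
  qed
  with grigK_conj_a.IH show ?case by (metis grigK.grigK_conj_l)
next
  case (grigK_conj_l k l)
  obtain l' where l': "grig_one l' = l" using grig_one_surj by blast
  \<comment> \<open>A letter acts as a letter only below \<open>1\<close>, so \<open>a\<close> first
    carries the copy of \<open>k\<close> there and finally back.\<close>
  have "place [0] (grig l \<circ> k \<circ> grig l) = grig_a \<circ> (grig l' \<circ> (grig_a \<circ> place [0] k \<circ> grig_a) \<circ> grig l') \<circ> grig_a"
  proof
    fix \<xi> :: bits
    show "place [0] (grig l \<circ> k \<circ> grig l) \<xi> = (grig_a \<circ> (grig l' \<circ> (grig_a \<circ> place [0] k \<circ> grig_a) \<circ> grig l') \<circ> grig_a) \<xi>"
      using l' by (cases \<xi> rule: stream_bit_cases)
       (cases l'; auto simp add: grig_rec)+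
  qed
  with grigK_conj_l.IH show ?case by (metis grigK.grigK_conj_l grigK.grigK_conj_a)
next
  case grigK_id
  show "place [0] id \<in> grigK" by (metis place_id grigK.grigK_id)
qed

lemma place_grigK: "k \<in> grigK \<Longrightarrow> place p k \<in> grigK"
proof (induction p)
  case (Cons i p)
  have "place [1] k = grig_a \<circ> place [0] k \<circ> grig_a" for k
  proof
    fix \<xi> :: bits
    show "place [1] k \<xi> = (grig_a \<circ> place [0] k \<circ> grig_a) \<xi>"
      by (cases \<xi> rule: stream_bit_cases) (simp_all add: grig_rec)
  qed
  then have "place [i] k \<in> grigK" if "k \<in> grigK" for k
    using place_0_grigK[OF that] grigK_conj_a by (cases i) auto
  from this[OF Cons.IH[OF Cons.prems]] show ?case
    using place_append[of "[i]" p k] by simp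
qed simp

section \<open>Self-replication, transitivity on levels and sections\<close>

lemma grigG_lift_1: "g \<in> grigG \<Longrightarrow> \<exists>h\<in>grigG. \<forall>\<zeta>. h (1 ## \<zeta>) = 1 ## g \<zeta>"
proof (induction rule: grigG.induct)
  case grigG_id
  then show ?case using grigG.grigG_id by (intro bexI[of _ id]) auto
next
  case (grigG_a g)
  then obtain h where "h \<in> grigG" "\<forall>\<zeta>. h (1 ## \<zeta>) = 1 ## g \<zeta>" by blast
  then show ?case
    \<comment> \<open>\<open>b\<close> acts as \<open>a\<close> below \<open>0\<close>, hence its
      conjugate \<open>aba\<close> does so below \<open>1\<close>.\<close>
    by (intro bexI[of _ "grig_a \<circ> grig_b \<circ> grig_a \<circ> h"]) (auto simp: grig_rec intro: grigG_comp grigG_generators)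
next
  case (grigG_l g l)
  then obtain h where "h \<in> grigG" "\<forall>\<zeta>. h (1 ## \<zeta>) = 1 ## g \<zeta>" by blast
  moreover obtain l' where "grig_one l' = l" using grig_one_surj by blast
  ultimately show ?case
    by (intro bexI[of _ "grig l' \<circ> h"]) (auto simp: grig_Cons intro: grigG_comp grigG_generators simp del: grig_letters)
qed

lemma grigG_lift:
  assumes "g \<in> grigG" shows "\<exists>h\<in>grigG. \<forall>\<zeta>. h (p @- \<zeta>) = p @- g \<zeta>"
proof (induction p)
  case (Cons i p)
  then obtain f where f: "f \<in> grigG" "\<And>\<zeta>. f (p @- \<zeta>) = p @- g \<zeta>" by blast
  obtain h where h: "h \<in> grigG" "\<And>\<zeta>. h (1 ## \<zeta>) = 1 ## f \<zeta>" using grigG_lift_1[OF f(1)] by blast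
  show ?case
  proof (cases "i = 0")
    case True
    then show ?thesis using f h
      by (intro bexI[of _ "grig_a \<circ> h \<circ> grig_a"]) (auto simp: grig_rec intro: grigG_comp grigG_generators)
  next
    case False
    then have "i = 1" by simp
    with f h show ?thesis by (intro bexI[of _ h]) auto
  qed
qed (use assms in auto)

text \<open>The tail is lifted by self-replication and the first digit corrected by
  \<open>a\<close>, which has trivial sections there. Thus the transporting element can be taken
  with trivial section at \<open>p\<close>.\<close>

lemma grigG_transitive: "length p = length q \<Longrightarrow> \<exists>g\<in>grigG. \<forall>\<zeta>. g (p @- \<zeta>) = q @- \<zeta>"
proof (induction p q rule: list_induct2)
  case Nil
  then show ?case using grigG_id by (intro bexI[of _ id]) auto
next
  case (Cons i p j q)
  then obtain g where g: "g \<in> grigG" "\<And>\<zeta>. g (p @- \<zeta>) = q @- \<zeta>" by blast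
  obtain h where h: "h \<in> grigG" "\<And>\<zeta>. h ([i] @- \<zeta>) = [i] @- g \<zeta>" using grigG_lift[OF g(1)] by blast
  show ?case
  proof (cases "i = j")
    case False
    then have "j = i + 1" by (cases i; cases j) auto
    then show ?thesis using g h
      by (intro bexI[of _ "grig_a \<circ> h"]) (auto simp: grig_Cons intro: grigG_comp grigG_generators)
  qed (use g h in \<open>auto intro!: bexI[of _ h]\<close>)
qed

lemma generator_section:
  shows "\<exists>q h. length q = length p \<and> h \<in> grigG \<and> (\<forall>\<zeta>. grig_a (p @- \<zeta>) = q @- h \<zeta>)"
    and "\<exists>q h. length q = length p \<and> h \<in> grigG \<and> (\<forall>\<zeta>. grig l (p @- \<zeta>) = q @- h \<zeta>)"
proof -
  show a: "\<exists>q h. length q = length p \<and> h \<in> grigG \<and> (\<forall>\<zeta>. grig_a (p @- \<zeta>) = q @- h \<zeta>)" for p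
  proof (cases p)
    case (Cons i p')
    then show ?thesis using grigG_id by (intro exI[of _ "(i + 1) # p'"] exI[of _ id]) (auto simp: grig_Cons)
  qed (auto intro: grigG_generators)
  show "\<exists>q h. length q = length p \<and> h \<in> grigG \<and> (\<forall>\<zeta>. grig l (p @- \<zeta>) = q @- h \<zeta>)"
  proof (induction p arbitrary: l)
    case Nil
    then show ?case using grigG_generators by (metis length_0_conv shift.simps(1))
  next
    case (Cons i p)
    show ?case
    proof (cases "i = 0")
      case True
      have "\<exists>q h. length q = length p \<and> h \<in> grigG \<and> (\<forall>\<zeta>. grig_zero l (p @- \<zeta>) = q @- h \<zeta>)"
        using a[of p] grigG_id by (cases l) (auto intro!: exI[of _ p])
      then obtain q h where "length q = length p" "h \<in> grigG" "\<And>\<zeta>. grig_zero l (p @- \<zeta>) = q @- h \<zeta>"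
        by blast
      with True show ?thesis
        by (intro exI[of _ "0 # q"] exI[of _ h]) (auto simp: grig_Cons simp del: grig_letters)
    next
      case False
      then have i: "i = 1" by simp
      obtain q h where "length q = length p" "h \<in> grigG" "\<And>\<zeta>. grig (grig_one l) (p @- \<zeta>) = q @- h \<zeta>"
        using Cons.IH[of "grig_one l"] by blast
      with i show ?thesis
        by (intro exI[of _ "1 # q"] exI[of _ h]) (auto simp: grig_Cons simp del: grig_letters)
    qed
  qed
qed

lemma grigG_section:
  "g \<in> grigG \<Longrightarrow> \<exists>q h. length q = length p \<and> h \<in> grigG \<and> (\<forall>\<zeta>. g (p @- \<zeta>) = q @- h \<zeta>)"
proof (induction rule: grigG.induct)
  case (grigG_a g)
  then obtain q h where 1: "length q = length p" "h \<in> grigG" "\<And>\<zeta>. g (p @- \<zeta>) = q @- h \<zeta>" by blast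
  obtain q' h' where "length q' = length q" "h' \<in> grigG" "\<And>\<zeta>. grig_a (q @- \<zeta>) = q' @- h' \<zeta>"
    using generator_section(1) by blast
  with 1 have "length q' = length p \<and> h' \<circ> h \<in> grigG \<and> (\<forall>\<zeta>. (grig_a \<circ> g) (p @- \<zeta>) = q' @- (h' \<circ> h) \<zeta>)"
    by (simp add: grigG_comp)
  then show ?case by blast
next
  case (grigG_l g l)
  then obtain q h where 1: "length q = length p" "h \<in> grigG" "\<And>\<zeta>. g (p @- \<zeta>) = q @- h \<zeta>" by blast
  obtain q' h' where "length q' = length q" "h' \<in> grigG" "\<And>\<zeta>. grig l (q @- \<zeta>) = q' @- h' \<zeta>"
    using generator_section(2) by blast
  with 1 have "length q' = length p \<and> h' \<circ> h \<in> grigG \<and> (\<forall>\<zeta>. (grig l \<circ> g) (p @- \<zeta>) = q' @- (h' \<circ> h) \<zeta>)"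
    by (simp add: grigG_comp)
  then show ?case by blast
next
  case grigG_id
  have "length p = length p \<and> id \<in> grigG \<and> (\<forall>\<zeta>. id (p @- \<zeta>) = p @- id \<zeta>)"
    by (simp add: grigG.grigG_id)
  then show ?case by blast
qed

text \<open>The group acts on every finite level, because its elements map the cone below a vertex
  into the cone below a vertex of the same level.\<close>

lemma grigG_stake:
  assumes "g \<in> grigG" "stake n \<xi> = stake n \<eta>" shows "stake n (g \<xi>) = stake n (g \<eta>)"
proof -
  obtain q h where "length q = n" "\<And>\<zeta>. g (stake n \<xi> @- \<zeta>) = q @- h \<zeta>"
    using grigG_section[OF assms(1), of "stake n \<xi>"] by auto
  then have "stake n (g (stake n \<xi> @- \<zeta>)) = q" for \<zeta>
    by (simp add: stake_shift)
  from this[of "sdrop n \<xi>"] this[of "sdrop n \<eta>"] show ?thesis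
    by (simp only: stake_sdrop assms(2)) (simp only: stake_sdrop flip: assms(2))
qed

section \<open>Perturbing generators to be injective on a ball\<close>

definition letter_map :: "('i \<Rightarrow> 'x \<Rightarrow> 'x) \<Rightarrow> 'i \<times> bool \<Rightarrow> 'x \<Rightarrow> 'x" where
  "letter_map X l = (if snd l then X (fst l) else finv (X (fst l)))"

text \<open>Words act on the right, first letter first, in agreement with the product of
  transformations. Extending a word at its end therefore extends the trajectory of a point.\<close>

definition act :: "('i \<Rightarrow> 'x \<Rightarrow> 'x) \<Rightarrow> ('i \<times> bool) list \<Rightarrow> 'x \<Rightarrow> 'x" where
  "act X w = fold (letter_map X) w"

lemma act_simps [simp]:
  "act X [] = id" "act X (l # w) \<xi> = act X w (letter_map X l \<xi>)"
  "act X (v @ w) \<xi> = act X w (act X v \<xi>)"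
  by (simp_all add: act_def)

lemma letter_map_simps [simp]:
  "letter_map X (i, True) = X i" "letter_map X (i, False) = finv (X i)"
  by (simp_all add: letter_map_def)

lemma reduced_snoc: "reduced (w @ [s]) \<Longrightarrow> reduced w \<and> (w \<noteq> [] \<longrightarrow> s \<noteq> inv_letter (last w))"
  by (induction w rule: reduced.induct) auto

definition ball_words :: "'i set \<Rightarrow> nat \<Rightarrow> ('i \<times> bool) list set" where
  "ball_words I n = {w. reduced w \<and> w \<in> lists (I \<times> UNIV) \<and> length w \<le> n}"

lemma finite_ball_words: "finite I \<Longrightarrow> finite (ball_words I n)"
  by (rule finite_subset[OF _ finite_lists_length_le[of "I \<times> UNIV" n]])
    (auto simp: ball_words_def)

text \<open>\<open>stays\<close> is demanded of all perturbations at once, so that the trajectory of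
  \<open>x0\<close> remains in the region where \<open>separating\<close> can be applied while the
  perturbation is still being built.\<close>

locale separating_perturbations =
  fixes I :: "'i set" and g :: "'i \<Rightarrow> 'x \<Rightarrow> 'x" and P :: "('x \<Rightarrow> 'x) set"
    and n :: nat and x0 :: 'x and V :: "'x set"
  assumes bij_g: "\<And>i. bij (g i)" and bij_P: "\<And>k. k \<in> P \<Longrightarrow> bij k"
    and id_P: "id \<in> P" and comp_P: "\<And>f k. f \<in> P \<Longrightarrow> k \<in> P \<Longrightarrow> f \<circ> k \<in> P"
    and stays: "\<And>k w. (\<And>i. k i \<in> P) \<Longrightarrow> w \<in> lists (I \<times> UNIV) \<Longrightarrow> length w \<le> n \<Longrightarrow>
       act (\<lambda>i. g i \<circ> k i) w x0 \<in> V"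
    and separating: "\<And>x F. x \<in> V \<Longrightarrow> finite F \<Longrightarrow> x \<notin> F \<Longrightarrow>
       \<exists>k\<in>P. (\<forall>y\<in>F. k y = y) \<and> k x \<noteq> x"
begin

text \<open>The generator \<open>i\<close> is changed near a single point \<open>\<omega>\<close>
  met by the last letter of the new word. No trajectory of an old word uses that letter at
  \<open>\<omega>\<close>, so the old images stay and only the new one moves away.\<close>

lemma extend_by_word:
  assumes k: "\<And>i. k i \<in> P" and T: "finite T" "T \<subseteq> ball_words I n"
    and prefix: "\<And>v s. v @ [s] \<in> T \<Longrightarrow> v \<in> T"
    and inj: "inj_on (\<lambda>w. act (\<lambda>i. g i \<circ> k i) w x0) T"
    and w: "w \<in> T" "w @ [(i, e)] \<notin> T" "w @ [(i, e)] \<in> ball_words I n"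
  shows "\<exists>k. (\<forall>i. k i \<in> P) \<and> inj_on (\<lambda>w. act (\<lambda>i. g i \<circ> k i) w x0) (insert (w @ [(i, e)]) T)"
proof -
  define X where "X = (\<lambda>i. g i \<circ> k i)"
  define \<phi> where "\<phi> = (\<lambda>w. act X w x0)"
  have bijX: "bij (X i)" for i unfolding X_def by (intro bij_comp bij_P k bij_g)
  have inj: "inj_on \<phi> T" using inj unfolding \<phi>_def X_def .
  have \<phi>_snoc: "\<phi> (v @ [(j, True)]) = X j (\<phi> v)" "X j (\<phi> (v @ [(j, False)])) = \<phi> v" for v j
    using bijX[of j] by (simp_all add: \<phi>_def bij_is_surj surj_f_inv_f)
  \<comment> \<open>After \<open>k'\<close> is inserted, the new word ends at
    \<open>X i (k' \<omega>)\<close> if its last letter is positive and at the preimage of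
    \<open>\<omega>\<close> under \<open>k'\<close> otherwise.\<close>
  define \<omega> where "\<omega> = (if e then \<phi> w else \<phi> (w @ [(i, e)]))"
  \<comment> \<open>Fixing the old images protects the old trajectories. Fixing their preimages
    under \<open>X i\<close> prevents \<open>X i (k' \<omega>)\<close> from hitting one of
    them.\<close>
  define F where "F = (\<phi> ` T \<union> finv (X i) ` \<phi> ` T) - {\<omega>}"
  have "\<omega> \<in> V"
    unfolding \<omega>_def \<phi>_def X_def using w T(2) by (auto intro!: stays k simp: ball_words_def simp del: act_simps)
  moreover have "finite F" unfolding F_def using T(1) by blast
  ultimately obtain k' where k': "k' \<in> P" "\<And>y. y \<in> F \<Longrightarrow> k' y = y" "k' \<omega> \<noteq> \<omega>"
    using separating[of \<omega> F] by (auto simp: F_def)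
  have bij_k': "bij k'" using k' bij_P by blast
  define K where "K = k(i := k i \<circ> k')"
  define X' where "X' = (\<lambda>j. g j \<circ> K j)"
  have X': "X' i = X i \<circ> k'" "j \<noteq> i \<Longrightarrow> X' j = X j" for j
    by (auto simp: X'_def X_def K_def)
  have bijX': "bij (X' j)" for j
    by (cases "j = i") (simp_all add: X' bijX bij_comp bij_k')
  have red: "reduced (w @ [(i, e)])" using w(3) by (simp add: ball_words_def)
  \<comment> \<open>By injectivity, an old word can use the letter \<open>i\<close> at
    \<open>\<omega>\<close> in two ways only: it is the new word, which is not in \<open>T\<close>,
    or it is \<open>w\<close> with a last letter inverse to the new one, which reducedness
    excludes.\<close>
  have snoc_eq: "act X' (v @ [(j, e')]) x0 = \<phi> (v @ [(j, e')])"
    if v: "v @ [(j, e')] \<in> T" and IH: "act X' v x0 = \<phi> v" for v j e'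
  proof (cases "j = i")
    case True
    have vT: "v \<in> T" using prefix v by blast
    show ?thesis
    proof (cases e')
      case e': True
      have "\<phi> v \<noteq> \<omega>"
      proof
        assume eq: "\<phi> v = \<omega>"
        show False
        proof (cases e)
          case True
          then have "v = w" using eq inj vT w(1) by (auto simp: \<omega>_def dest: inj_onD)
          then show False using v w(2) True e' \<open>j = i\<close> by simp
        next
          case False
          then have "\<phi> (v @ [(i, True)]) = \<phi> w" using eq \<phi>_snoc by (simp add: \<omega>_def)
          then have "v @ [(i, True)] = w" using inj v w(1) e' \<open>j = i\<close> by (auto dest: inj_onD)
          then show False using red False reduced_snoc[of w "(i, e)"] by (auto simp: inv_letter_def)
        qed
      qed
      then have "k' (\<phi> v) = \<phi> v" using k'(2) vT by (auto simp: F_def)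
      then show ?thesis using True e' IH \<phi>_snoc by (simp add: X')
    next
      case e': False
      have "\<phi> (v @ [(i, False)]) \<noteq> \<omega>"
      proof
        assume eq: "\<phi> (v @ [(i, False)]) = \<omega>"
        show False
        proof (cases e)
          case True
          then have "v @ [(i, False)] = w" using eq inj v e' \<open>j = i\<close> w(1) by (auto simp: \<omega>_def dest: inj_onD)
          then show False using red True reduced_snoc[of w "(i, e)"] by (auto simp: inv_letter_def)
        next
          case False
          then have "\<phi> v = \<phi> w" using eq \<phi>_snoc(2) by (metis \<omega>_def)
          then have "v = w" using inj vT w(1) by (auto dest: inj_onD)
          then show False using v w(2) False e' \<open>j = i\<close> by simp
        qed
      qed
      then have "k' (\<phi> (v @ [(i, False)])) = \<phi> (v @ [(i, False)])"
        using k'(2) v True e' by (auto simp: F_def)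
      then have "X' i (\<phi> (v @ [(i, False)])) = \<phi> v" by (simp add: X' \<phi>_snoc)
      then have "finv (X' i) (\<phi> v) = \<phi> (v @ [(i, False)])"
        using bijX'[of i] by (metis bij_inv_eq_iff)
      then show ?thesis using True e' IH by simp
    qed
  next
    case False
    then show ?thesis using IH by (cases e') (simp_all add: X' \<phi>_def)
  qed
  have same: "act X' v x0 = \<phi> v" if "v \<in> T" for v
    using that
  proof (induction v rule: rev_induct)
    case (snoc s v)
    then show ?case using snoc_eq[of v "fst s" "snd s"] prefix by auto
  qed (simp add: \<phi>_def)
  have new: "act X' (w @ [(i, e)]) x0 \<noteq> \<phi> h" if h: "h \<in> T" for h
  proof
    assume eq: "act X' (w @ [(i, e)]) x0 = \<phi> h"
    show False
    proof (cases e)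
      case True
      then have "X i (k' \<omega>) = \<phi> h" using eq same[OF w(1)] by (simp add: X' \<omega>_def)
      then have "k' \<omega> = finv (X i) (\<phi> h)" using bijX by (metis bij_inv_eq_iff)
      \<comment> \<open>A point of \<open>F\<close> is fixed by \<open>k'\<close>, so
        \<open>k' \<omega>\<close> and \<open>\<omega>\<close> would have the same image under the
        injective \<open>k'\<close>.\<close>
      then have "k' \<omega> \<in> F" using h k'(3) by (auto simp: F_def)
      then have "k' (k' \<omega>) = k' \<omega>" by (rule k'(2))
      then show False using k'(3) bij_k' by (simp add: bij_is_inj inj_eq)
    next
      case False
      then have "X i (k' (\<phi> h)) = \<phi> w" using eq same[OF w(1)] bijX'[of i]
        by simp (metis X'(1) bij_inv_eq_iff comp_apply)
      moreover have "X i \<omega> = \<phi> w" using False \<phi>_snoc(2) by (metis \<omega>_def)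
      ultimately have "k' (\<phi> h) = \<omega>" using bijX by (metis bij_is_inj injD)
      moreover have "\<phi> h \<noteq> \<omega>" using calculation k'(3) by auto
      ultimately show False using k'(2)[of "\<phi> h"] h by (auto simp: F_def)
    qed
  qed
  have "inj_on (\<lambda>w. act X' w x0) (insert (w @ [(i, e)]) T)"
  proof -
    have "inj_on (\<lambda>w. act X' w x0) T \<longleftrightarrow> inj_on \<phi> T" by (rule inj_on_cong) (rule same)
    moreover have "act X' (w @ [(i, e)]) x0 \<notin> (\<lambda>w. act X' w x0) ` T"
      using new same by (auto simp del: act_simps)
    ultimately show ?thesis using inj w(2) by (simp add: inj_on_insert del: act_simps)
  qed
  moreover have "\<forall>j. K j \<in> P" using k k'(1) comp_P by (simp add: K_def)
  ultimately show ?thesis unfolding X'_def by blast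
qed

lemma inj_on_prefix_closed:
  assumes "finite T" "T \<subseteq> ball_words I n" "\<And>v s. v @ [s] \<in> T \<Longrightarrow> v \<in> T"
  shows "\<exists>k. (\<forall>i. k i \<in> P) \<and> inj_on (\<lambda>w. act (\<lambda>i. g i \<circ> k i) w x0) T"
  using assms
proof (induction "card T" arbitrary: T)
  case 0
  then show ?case by (intro exI[of _ "\<lambda>_. id"] conjI allI id_P) simp
next
  case (Suc m)
  have "T \<noteq> {}" using Suc by auto
  define L where "L = Max (length ` T)"
  have "L \<in> length ` T" unfolding L_def using Suc \<open>T \<noteq> {}\<close> by (intro Max_in) auto
  then obtain u where u: "u \<in> T" "length u = L" by blast
  have max: "length v \<le> length u" if "v \<in> T" for v
    unfolding u(2) L_def using Suc.prems(1) that by simp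
  show ?case
  proof (cases u rule: rev_cases)
    case Nil
    then have "T \<subseteq> {[]}" using max by auto
    then show ?thesis
      by (intro exI[of _ "\<lambda>_. id"] conjI allI id_P) (auto simp: inj_on_def)
  next
    case (snoc w s)
    let ?T = "T - {u}"
    \<comment> \<open>A word of maximal length is a proper prefix of no word in \<open>T\<close>, so
      removing it preserves closure under prefixes.\<close>
    have pre: "v \<in> ?T" if "v @ [s] \<in> ?T" for v s
      using that Suc.prems(3)[of v s] max[of "v @ [s]"] by auto
    have T': "finite ?T" "?T \<subseteq> ball_words I n" "card ?T = m"
      using Suc.hyps(2) Suc.prems(1,2) u(1) by (auto simp: card_Diff_singleton)
    obtain k where k: "\<And>i. k i \<in> P" "inj_on (\<lambda>w. act (\<lambda>i. g i \<circ> k i) w x0) ?T"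
      using Suc.hyps(1)[OF T'(3)[symmetric] T'(1,2)] pre by blast
    have w: "w \<in> ?T" using Suc.prems(3)[of w s] u snoc by auto
    have u': "w @ [(fst s, snd s)] = u" using snoc by simp
    have "insert u ?T = T" using u(1) by blast
    moreover have "u \<in> ball_words I n" using u(1) Suc.prems(2) by blast
    moreover have "\<exists>k. (\<forall>i. k i \<in> P) \<and> inj_on (\<lambda>w. act (\<lambda>i. g i \<circ> k i) w x0) (insert (w @ [(fst s, snd s)]) ?T)"
    proof (rule extend_by_word[OF k(1) T'(1,2) _ k(2) w])
      show "v \<in> ?T" if "v @ [s] \<in> ?T" for v s using that by (rule pre)
    qed (use u' calculation in auto)
    ultimately show ?thesis by (simp only: u')
  qed
qed

theorem exists_injective_on_ball:
  assumes "finite I"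
  shows "\<exists>k. (\<forall>i. k i \<in> P) \<and> inj_on (\<lambda>w. act (\<lambda>i. g i \<circ> k i) w x0) (ball_words I n)"
proof (rule inj_on_prefix_closed[OF finite_ball_words[OF assms] order_refl])
  fix v s assume "v @ [s] \<in> ball_words I n"
  then show "v \<in> ball_words I n" using reduced_snoc[of v s] by (simp add: ball_words_def)
qed

end

section \<open>Balls in Cayley graphs\<close>

lemma (in group) ball_vertices_carrier:
  assumes "T \<subseteq> carrier G" shows "ball_vertices (cayley_graph G T) R \<subseteq> carrier G"
proof (induction R)
  case (Suc R)
  then show ?case using assms by (auto simp: cayley_graph_def)
qed (simp add: cayley_graph_def)

lemma (in group_hom) ball_vertices_image:
  assumes T: "T \<subseteq> carrier G"
  shows "ball_vertices (cayley_graph H (h ` T)) R = h ` ball_vertices (cayley_graph G T) R"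
proof (induction R)
  case 0
  then show ?case by (simp add: cayley_graph_def)
next
  case (Suc R)
  let ?B = "ball_vertices (cayley_graph G T) R"
  have B: "?B \<subseteq> carrier G" using G.ball_vertices_carrier T by blast
  \<comment> \<open>Edges traversed backwards are multiplications by inverse generators; in this
    form the set of neighbours is visibly compatible with homomorphisms.\<close>
  have step: "{y. \<exists>x\<in>B. \<exists>l. (x, l, y) \<in> edges (cayley_graph K S) \<or> (y, l, x) \<in> edges (cayley_graph K S)} =
      (\<lambda>(x, t). x \<otimes>\<^bsub>K\<^esub> t) ` (B \<times> S) \<union> (\<lambda>(x, t). x \<otimes>\<^bsub>K\<^esub> inv\<^bsub>K\<^esub> t) ` (B \<times> S)"
    if K: "group K" and BS: "B \<subseteq> carrier K" "S \<subseteq> carrier K" for K :: "('e, 'f) monoid_scheme" and B S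
  proof -
    interpret K: group K by fact
    show ?thesis
    proof (intro equalityI subsetI)
      fix y assume "y \<in> {y. \<exists>x\<in>B. \<exists>l. (x, l, y) \<in> edges (cayley_graph K S) \<or> (y, l, x) \<in> edges (cayley_graph K S)}"
      then obtain x l where x: "x \<in> B" and "(x, l, y) \<in> edges (cayley_graph K S) \<or> (y, l, x) \<in> edges (cayley_graph K S)"
        by blast
      then have "l \<in> S" "y \<in> carrier K" "y = x \<otimes>\<^bsub>K\<^esub> l \<or> x = y \<otimes>\<^bsub>K\<^esub> l" using BS by (auto simp: cayley_graph_def)
      moreover from this have "y = x \<otimes>\<^bsub>K\<^esub> l \<or> y = x \<otimes>\<^bsub>K\<^esub> inv\<^bsub>K\<^esub> l" using BS by (auto simp: K.m_assoc)
      ultimately show "y \<in> (\<lambda>(x, t). x \<otimes>\<^bsub>K\<^esub> t) ` (B \<times> S) \<union> (\<lambda>(x, t). x \<otimes>\<^bsub>K\<^esub> inv\<^bsub>K\<^esub> t) ` (B \<times> S)"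
        using x by force
    next
      fix y assume "y \<in> (\<lambda>(x, t). x \<otimes>\<^bsub>K\<^esub> t) ` (B \<times> S) \<union> (\<lambda>(x, t). x \<otimes>\<^bsub>K\<^esub> inv\<^bsub>K\<^esub> t) ` (B \<times> S)"
      then obtain x t where x: "x \<in> B" "t \<in> S" and y: "y = x \<otimes>\<^bsub>K\<^esub> t \<or> y = x \<otimes>\<^bsub>K\<^esub> inv\<^bsub>K\<^esub> t" by auto
      have "(x, t, y) \<in> edges (cayley_graph K S) \<or> (y, t, x) \<in> edges (cayley_graph K S)"
        using x y BS by (auto simp: cayley_graph_def K.m_assoc subset_iff)
      with x show "y \<in> {y. \<exists>x\<in>B. \<exists>l. (x, l, y) \<in> edges (cayley_graph K S) \<or> (y, l, x) \<in> edges (cayley_graph K S)}"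
        by blast
    qed
  qed
  have img: "h ` ((\<lambda>(x, t). x \<otimes>\<^bsub>G\<^esub> t) ` (?B \<times> T)) = (\<lambda>(x, t). x \<otimes>\<^bsub>H\<^esub> t) ` ((h ` ?B) \<times> (h ` T))"
    "h ` ((\<lambda>(x, t). x \<otimes>\<^bsub>G\<^esub> inv\<^bsub>G\<^esub> t) ` (?B \<times> T)) = (\<lambda>(x, t). x \<otimes>\<^bsub>H\<^esub> inv\<^bsub>H\<^esub> t) ` ((h ` ?B) \<times> (h ` T))"
    using B T by (force simp: image_iff)+
  have "h ` ?B \<subseteq> carrier H" "h ` T \<subseteq> carrier H" using B T by auto
  then show ?case
    by (simp only: ball_vertices.simps Suc.IH step[OF H.group_axioms] step[OF G.group_axioms B T] image_Un img)
qed

text \<open>The radius is increased by one so that endpoints in the ball determine the label of an edge.\<close>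

lemma (in group_hom) cayley_ball_iso:
  assumes T: "T \<subseteq> carrier G"
    and inj: "inj_on h (ball_vertices (cayley_graph G T) (Suc R))"
    and \<beta>: "\<And>t. t \<in> T \<Longrightarrow> \<beta> (h t) = t"
  shows "rooted_labelled_iso \<beta> (graph_ball (cayley_graph H (h ` T)) R) (graph_ball (cayley_graph G T) R)"
proof -
  let ?B = "ball_vertices (cayley_graph G T)"
  have B: "?B R \<subseteq> carrier G" using G.ball_vertices_carrier T by blast
  have BS: "?B R \<subseteq> ?B (Suc R)" by auto
  have injR: "inj_on h (?B R)" using inj BS by (rule inj_on_subset)
  define \<phi> where "\<phi> = the_inv_into (?B R) h"
  have \<phi>: "\<phi> (h u) = u" if "u \<in> ?B R" for u
    unfolding \<phi>_def using the_inv_into_f_f[OF injR that] .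
  have one: "\<one>\<^bsub>G\<^esub> \<in> ?B R"
    by (induction R) (auto simp: cayley_graph_def)
  have 1: "bij_betw \<phi> (h ` ?B R) (?B R)"
    unfolding \<phi>_def by (rule bij_betw_the_inv_into) (rule inj_on_imp_bij_betw[OF injR])
  have edge: "u \<otimes>\<^bsub>G\<^esub> t = v" if "u \<in> ?B R" "v \<in> ?B R" "t \<in> T" "h u \<otimes>\<^bsub>H\<^esub> h t = h v" for u v t
  proof -
    have "u \<otimes>\<^bsub>G\<^esub> t \<in> ?B (Suc R)" using that B by (auto simp: cayley_graph_def)
    moreover have "h (u \<otimes>\<^bsub>G\<^esub> t) = h v" using that B T by (simp add: subset_iff)
    ultimately show ?thesis using inj that(2) BS by (auto dest: inj_onD)
  qed
  have 2: "(\<lambda>(x, l, y). (\<phi> x, \<beta> l, \<phi> y)) ` edges (graph_ball (cayley_graph H (h ` T)) R)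
    = edges (graph_ball (cayley_graph G T) R)" (is "?f ` ?E = ?E'")
  proof (intro equalityI subsetI)
    fix e assume "e \<in> ?f ` ?E"
    then obtain u t v where "u \<in> ?B R" "v \<in> ?B R" "t \<in> T" "h u \<otimes>\<^bsub>H\<^esub> h t = h v"
      and e: "e = ?f (h u, h t, h v)"
      by (auto simp: graph_ball_def ball_vertices_image[OF T]) (auto simp: cayley_graph_def)
    then show "e \<in> ?E'" using edge[of u v t] B
      by (auto simp: graph_ball_def \<phi> \<beta>) (auto simp: cayley_graph_def)
  next
    fix e assume "e \<in> ?E'"
    then obtain u t v where uv: "u \<in> ?B R" "v \<in> ?B R" "t \<in> T" "u \<otimes>\<^bsub>G\<^esub> t = v" and e: "e = (u, t, v)"
      by (auto simp: graph_ball_def) (auto simp: cayley_graph_def)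
    then have "h u \<otimes>\<^bsub>H\<^esub> h t = h v" using B T by (auto simp: subset_iff)
    then have "(h u, h t, h v) \<in> ?E" using uv B T
      by (auto simp: graph_ball_def ball_vertices_image[OF T]) (auto simp: cayley_graph_def)
    moreover have "e = ?f (h u, h t, h v)" using uv e by (simp add: \<phi> \<beta>)
    ultimately show "e \<in> ?f ` ?E" by blast
  qed
  have 3: "\<phi> \<one>\<^bsub>H\<^esub> = \<one>\<^bsub>G\<^esub>" using \<phi>[OF one] by simp
  show ?thesis unfolding rooted_labelled_iso_def
  proof (intro exI[of _ \<phi>] conjI)
    show "bij_betw \<phi> (vertices (graph_ball (cayley_graph H (h ` T)) R)) (vertices (graph_ball (cayley_graph G T) R))"
      using 1 by (simp add: graph_ball_def ball_vertices_image[OF T])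
    show "\<phi> (root (graph_ball (cayley_graph H (h ` T)) R)) = root (graph_ball (cayley_graph G T) R)"
      using 3 by (simp add: graph_ball_def cayley_graph_def)
  qed (rule 2)
qed

text \<open>The generating sets are the images of \<open>T\<close>. The \<open>n\<close>-th
  homomorphism is injective on radius \<open>n + 1\<close>, hence gives isomorphic balls of every
  radius \<open>R \<le> n\<close>. The ball of radius one contains \<open>T\<close>, which makes the
  labels correspond bijectively.\<close>

lemma preforms_if_homs:
  assumes G: "group G" and F: "group F" and T: "finite_generating_set F T"
    and hom: "\<And>n. h n \<in> hom F G" and surj: "\<And>n. h n ` carrier F = carrier G"
    and inj: "\<And>n. inj_on (h n) (ball_vertices (cayley_graph F T) (Suc n))"
  shows "preforms G F"
proof -
  have h: "group_hom F G (h n)" for n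
    by (simp add: group_hom_def group_hom_axioms_def G F hom)
  have TF: "T \<subseteq> carrier F" "finite T" "generate F T = carrier F"
    using T by (auto simp: finite_generating_set_def)
  have mono: "ball_vertices \<Gamma> m \<subseteq> ball_vertices \<Gamma> n" if "m \<le> n" for \<Gamma> :: "('v, 'l) rlgraph" and m n
    using that by (induction rule: dec_induct) auto
  have "T \<subseteq> ball_vertices (cayley_graph F T) 1"
  proof
    fix t assume t: "t \<in> T"
    then have "(\<one>\<^bsub>F\<^esub>, t, t) \<in> edges (cayley_graph F T)"
      using TF(1) monoid.l_one[OF group.is_monoid[OF F], of t] monoid.one_closed[OF group.is_monoid[OF F]]
      by (auto simp: cayley_graph_def)
    then show "t \<in> ball_vertices (cayley_graph F T) 1" by (auto simp: cayley_graph_def)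
  qed
  moreover have "ball_vertices (cayley_graph F T) 1 \<subseteq> ball_vertices (cayley_graph F T) (Suc n)" for n
    by (rule mono) simp
  ultimately have "T \<subseteq> ball_vertices (cayley_graph F T) (Suc n)" for n
    by (rule subset_trans)
  then have injT: "inj_on (h n) T" for n by (rule inj_on_subset[OF inj])
  define \<beta> where "\<beta> n = the_inv_into T (h n)" for n
  have \<beta>: "\<beta> n (h n t) = t" if "t \<in> T" for n t
    unfolding \<beta>_def using the_inv_into_f_f[OF injT that] .
  show ?thesis unfolding preforms_def
  proof (intro exI[of _ T] exI[of _ "\<lambda>n. h n ` T"] exI[of _ \<beta>] conjI allI T)
    fix n
    show "finite_generating_set G (h n ` T)"
      using TF group_hom.generate_img[OF h TF(1), of n] surj[of n] hom[of n]
      by (auto simp: finite_generating_set_def hom_def Pi_iff)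
    show "bij_betw (\<beta> n) (h n ` T) T"
      unfolding \<beta>_def by (rule bij_betw_the_inv_into) (rule inj_on_imp_bij_betw[OF injT])
  next
    fix R
    have "rooted_labelled_iso (\<beta> n) (graph_ball (cayley_graph G (h n ` T)) R) (graph_ball (cayley_graph F T) R)"
      if "n \<ge> R" for n
      by (rule group_hom.cayley_ball_iso[OF h TF(1) inj_on_subset[OF inj mono] \<beta>]) (use that in auto)
    then show "\<forall>\<^sub>F n in sequentially. rooted_labelled_iso (\<beta> n)
        (graph_ball (cayley_graph G (h n ` T)) R) (graph_ball (cayley_graph F T) R)"
      unfolding eventually_sequentially by blast
  qed
qed

lemma free_group_finite_generating_set:
  assumes "finite X"
  shows "finite_generating_set (free_group X) ((\<lambda>x. [(x, True)]) ` X)"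
proof -
  interpret F: group "free_group X" by (rule group_free_group)
  let ?T = "(\<lambda>x. [(x, True)]) ` X"
  have T: "?T \<subseteq> carrier (free_group X)" by (auto simp: free_group_def)
  have inv: "inv\<^bsub>free_group X\<^esub> [(x, True)] = [(x, False)]" if "x \<in> X" for x
    by (rule F.inv_equality) (use that in \<open>auto simp: free_group_def inv_letter_def\<close>)
  have "w \<in> generate (free_group X) ?T" if "w \<in> carrier (free_group X)" for w
    using that
  proof (induction w)
    case Nil
    then show ?case using generate.one[of "free_group X" ?T] by (simp add: free_group_def)
  next
    case (Cons l w)
    obtain x e where l: "l = (x, e)" by (cases l)
    have x: "x \<in> X" "w \<in> carrier (free_group X)" using Cons.prems l by (auto simp: free_group_def reduced_Cons)
    have "l # w = [l] \<otimes>\<^bsub>free_group X\<^esub> w"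
      using Cons.prems by (simp add: free_group_def cons_reduce_eq_Cons)
    moreover have "[l] \<in> generate (free_group X) ?T"
      using x(1) generate.incl[of "[(x, True)]" ?T] generate.inv[of "[(x, True)]" ?T "free_group X"] inv[OF x(1)]
      by (cases e) (auto simp: l)
    ultimately show ?case using Cons.IH[OF x(2)] by (metis generate.eng)
  qed
  then show ?thesis using assms T F.generate_in_carrier[OF T]
    by (auto simp: finite_generating_set_def)
qed

text \<open>One step in the Cayley graph lengthens a reduced word by at most one letter. Injectivity
  passes to subsets, so this inclusion transfers it from reduced words to the ball.\<close>

lemma free_group_ball_vertices:
  "ball_vertices (cayley_graph (free_group X) ((\<lambda>x. [(x, True)]) ` X)) R \<subseteq>
     {w \<in> carrier (free_group X). length w \<le> R}" (is "ball_vertices ?\<Gamma> R \<subseteq> _")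
proof (induction R)
  case 0
  then show ?case by (simp add: cayley_graph_def) (simp add: free_group_def)
next
  case (Suc R)
  interpret F: group "free_group X" by (rule group_free_group)
  have inv: "inv\<^bsub>free_group X\<^esub> [(x, True)] = [(x, False)]" if "x \<in> X" for x
    by (rule F.inv_equality) (use that in \<open>auto simp: free_group_def inv_letter_def\<close>)
  have len: "length (foldr cons_reduce u v) \<le> length u + length v" for u v :: "('a \<times> bool) list"
  proof (induction u)
    case (Cons l u)
    have "length (cons_reduce l w) \<le> Suc (length w)" for w by (cases w) auto
    from this[of "foldr cons_reduce u v"] Cons show ?case by simp
  qed simp
  have lenF: "length (u \<otimes>\<^bsub>free_group X\<^esub> v) \<le> length u + length v" for u v
    using len by (simp add: free_group_def)
  show ?case
  proof
    fix w assume "w \<in> ball_vertices ?\<Gamma> (Suc R)"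
    then consider "w \<in> ball_vertices ?\<Gamma> R" | u x where "u \<in> ball_vertices ?\<Gamma> R" "x \<in> X" "w = u \<otimes>\<^bsub>free_group X\<^esub> [(x, True)]"
      | u x where "u \<in> ball_vertices ?\<Gamma> R" "x \<in> X" "w \<in> carrier (free_group X)" "u = w \<otimes>\<^bsub>free_group X\<^esub> [(x, True)]"
      by (auto simp: cayley_graph_def)
    then show "w \<in> {w \<in> carrier (free_group X). length w \<le> Suc R}"
    proof cases
      case 1
      then show ?thesis using Suc by auto
    next
      case (2 u x)
      then have "[(x, True)] \<in> carrier (free_group X)" "u \<in> carrier (free_group X)" "length u \<le> R"
        using Suc by (auto simp: free_group_def)
      then show ?thesis using lenF[of u "[(x, True)]"] 2 by auto
    next
      case (3 u x)
      then have x: "[(x, True)] \<in> carrier (free_group X)" "u \<in> carrier (free_group X)" "length u \<le> R"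
        using Suc by (auto simp: free_group_def)
      then have "w = u \<otimes>\<^bsub>free_group X\<^esub> [(x, False)]"
        using 3 inv[OF 3(2)] F.inv_solve_right' by metis
      then show ?thesis using lenF[of u "[(x, False)]"] 3 x by auto
    qed
  qed
qed

section \<open>Perturbations below a level\<close>

text \<open>The two factors \<open>b\<close> see opposite first digits. Exactly one of them sees
  \<open>0\<close> and flips the second digit; the other one keeps it.\<close>

lemma grig_t_snth: "shd (grig_t \<zeta>) = shd \<zeta>" "grig_t \<zeta> !! 1 = \<zeta> !! 1 + 1"
proof -
  obtain x y w where "\<zeta> = x ## y ## w" by (metis stream.collapse)
  then show "shd (grig_t \<zeta>) = shd \<zeta>" "grig_t \<zeta> !! 1 = \<zeta> !! 1 + 1"
    by (cases x; cases y; simp add: grig_t_def grig_rec)+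
qed

lemma grig_t_neq: "grig_t \<zeta> \<noteq> \<zeta>"
  using grig_t_snth(2)[of \<zeta>] by (metis add_cancel_left_right zero_neq_one)

text \<open>The triple \<open>a\<close>, \<open>b\<close>, \<open>c\<close> generates, as
  \<open>d\<close> is \<open>bc\<close>. All indices above \<open>1\<close> denote \<open>c\<close>,
  so facts about the triple hold for every index.\<close>

definition grig_gen :: "nat \<Rightarrow> bits \<Rightarrow> bits" where
  "grig_gen i = (if i = 0 then grig_a else if i = 1 then grig_b else grig_c)"

lemma grig_gen_simps [simp]: "grig_gen 0 = grig_a" "grig_gen (Suc 0) = grig_b" "grig_gen 2 = grig_c"
  by (simp_all add: grig_gen_def)

lemma grig_gen_grigG: "grig_gen i \<in> grigG" and grig_gen_grig_gen [simp]: "grig_gen i (grig_gen i \<xi>) = \<xi>"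
  by (auto simp: grig_gen_def grigG_generators)

lemma inv_grig_gen: "finv (grig_gen i) = grig_gen i"
  by (rule inv_equality) simp_all

lemma fold_grig_gen_grigG: "fold grig_gen W \<in> grigG"
proof (induction W)
  case Nil
  show "fold grig_gen [] \<in> grigG" using grigG_id by simp
next
  case (Cons i W)
  then show "fold grig_gen (i # W) \<in> grigG" by (simp add: grigG_comp grig_gen_grigG)
qed

lemma grigG_fold_grig_gen: "g \<in> grigG \<Longrightarrow> \<exists>W\<in>lists {0, 1, 2}. g = fold grig_gen W"
proof (induction rule: grigG.induct)
  case grigG_id
  have "id = fold grig_gen []" by simp
  then show ?case by blast
next
  case (grigG_a g)
  then obtain W where "W \<in> lists {0, 1, 2}" "g = fold grig_gen W" by blast
  then have "W @ [0] \<in> lists {0, 1, 2}" "grig_a \<circ> g = fold grig_gen (W @ [0])" by auto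
  then show ?case by blast
next
  case (grigG_l g l)
  then obtain W where W: "W \<in> lists {0, 1, 2}" "g = fold grig_gen W" by blast
  have "grig_d = grig_b \<circ> grig_c" by (simp add: fun_eq_iff grig_grig)
  then have "grig Letter_b \<circ> g = fold grig_gen (W @ [1])" "grig Letter_c \<circ> g = fold grig_gen (W @ [2])"
    "grig Letter_d \<circ> g = fold grig_gen (W @ [2, 1])" using W(2) by (auto simp: comp_assoc)
  moreover have "W @ [1] \<in> lists {0, 1, 2}" "W @ [2] \<in> lists {0, 1, 2}" "W @ [2, 1] \<in> lists {0, 1, 2}"
    using W(1) by auto
  ultimately show ?case by (cases l) blast+
qed

text \<open>Conjugation by \<open>h\<close> moves the support from \<open>p\<close> to
  \<open>q = h(p)\<close> and conjugates the inner map by the section of \<open>h\<close> at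
  \<open>p\<close>.\<close>

lemma conj_place:
  assumes "bij h" "\<And>\<zeta>. h (p @- \<zeta>) = q @- g \<zeta>" "bij g" "length q = length p"
  shows "h \<circ> place p k \<circ> finv h = place q (g \<circ> k \<circ> finv g)"
proof (rule fun_eq_by_vertex[of _ q])
  have inv: "finv h (q @- \<zeta>) = p @- finv g \<zeta>" for \<zeta>
    using assms(1,3) by (intro inv_f_eq) (simp_all add: assms(2) bij_is_inj bij_is_surj surj_f_inv_f)
  show "(h \<circ> place p k \<circ> finv h) (q @- \<zeta>) = place q (g \<circ> k \<circ> finv g) (q @- \<zeta>)" for \<zeta>
    by (simp add: inv assms(2))
  fix \<xi> assume out: "stake (length q) \<xi> \<noteq> q"
  have "stake (length p) (finv h \<xi>) \<noteq> p"
  proof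
    assume "stake (length p) (finv h \<xi>) = p"
    then have "finv h \<xi> = p @- sdrop (length p) (finv h \<xi>)" by (metis stake_sdrop)
    then have "\<xi> = q @- g (sdrop (length p) (finv h \<xi>))" by (metis assms(1,2) bij_inv_eq_iff)
    then have "stake (length q) \<xi> = stake (length q) (q @- g (sdrop (length p) (finv h \<xi>)))" by simp
    then show False using out by (simp add: stake_shift)
  qed
  then show "(h \<circ> place p k \<circ> finv h) \<xi> = place q (g \<circ> k \<circ> finv g) \<xi>"
    using out assms(1) by (simp add: place_outside bij_is_surj surj_f_inv_f)
qed

section \<open>Products of elements of the branching subgroup acting below the vertices
  \<open>pz\<close>\<close>

inductive_set perturbations :: "bit list set \<Rightarrow> bit list \<Rightarrow> (bits \<Rightarrow> bits) set" for U z where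
  perturbations_id: "id \<in> perturbations U z"
| perturbations_step: "f \<in> perturbations U z \<Longrightarrow> p \<in> U \<Longrightarrow> k \<in> grigK \<Longrightarrow> place (p @ z) k \<circ> f \<in> perturbations U z"

lemma perturbations_grigK: "f \<in> perturbations U z \<Longrightarrow> f \<in> grigK"
  by (induction rule: perturbations.induct) (blast intro: grigK_id grigK_comp place_grigK)+

lemma perturbations_mono: "f \<in> perturbations U z \<Longrightarrow> U \<subseteq> U' \<Longrightarrow> f \<in> perturbations U' z"
  by (induction rule: perturbations.induct) (blast intro: perturbations.intros)+

lemma perturbations_place: "p \<in> U \<Longrightarrow> k \<in> grigK \<Longrightarrow> place (p @ z) k \<in> perturbations U z"
  using perturbations_step[OF perturbations_id, of p U k z] by simp

lemma perturbations_comp: "f \<in> perturbations U z \<Longrightarrow> g \<in> perturbations U z \<Longrightarrow> f \<circ> g \<in> perturbations U z"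
proof (induction rule: perturbations.induct)
  case perturbations_id
  then show "id \<circ> g \<in> perturbations U z" by simp
next
  case (perturbations_step f p k)
  then have "f \<circ> g \<in> perturbations U z" by blast
  with perturbations_step show "place (p @ z) k \<circ> f \<circ> g \<in> perturbations U z" by (simp add: comp_assoc perturbations.perturbations_step)
qed

text \<open>Vertices of equal length have disjoint cones, so below \<open>p\<close> only the factors
  placed at \<open>pz\<close> are felt, and their product is collected in
  \<open>\<kappa>\<close>.\<close>

lemma perturbations_section:
  assumes "f \<in> perturbations U z" "\<And>q. q \<in> U \<Longrightarrow> length q = length p"
  shows "\<exists>\<kappa>\<in>grigK. (\<forall>\<zeta>. f (p @- \<zeta>) = p @- place z \<kappa> \<zeta>) \<and> (p \<notin> U \<longrightarrow> \<kappa> = id)"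
  using assms(1)
proof (induction rule: perturbations.induct)
  case perturbations_id
  have "\<forall>\<zeta>. id (p @- \<zeta>) = p @- place z id \<zeta>" by simp
  then show ?case by (intro bexI[of _ id] grigK_id) blast
next
  case (perturbations_step f q k)
  then obtain \<kappa> where \<kappa>: "\<kappa> \<in> grigK" "\<And>\<zeta>. f (p @- \<zeta>) = p @- place z \<kappa> \<zeta>" "p \<notin> U \<longrightarrow> \<kappa> = id" by blast
  show ?case
  proof (cases "q = p")
    case True
    have "(place (q @ z) k \<circ> f) (p @- \<zeta>) = p @- place z (k \<circ> \<kappa>) \<zeta>" for \<zeta>
      using \<kappa>(2) by (simp add: place_append place_comp True)
    moreover have "k \<circ> \<kappa> \<in> grigK" using \<kappa>(1) perturbations_step by (intro grigK_comp)
    ultimately show ?thesis using True perturbations_step(2) by blast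
  next
    case False
    have "place (q @ z) k (p @- \<zeta>) = p @- \<zeta>" for \<zeta>
      using False assms(2)[OF perturbations_step(2)] by (simp add: place_append place_outside stake_shift)
    then show ?thesis using \<kappa> by auto
  qed
qed

lemma perturbations_moved: "f \<in> perturbations U z \<Longrightarrow> f \<xi> \<noteq> \<xi> \<Longrightarrow> \<exists>p\<in>U. stake (length (p @ z)) \<xi> = p @ z"
proof (induction arbitrary: \<xi> rule: perturbations.induct)
  case (perturbations_step f p k)
  then show ?case by (metis comp_apply place_outside)
qed simp

lemma perturbations_stake:
  assumes "f \<in> perturbations U z" "\<And>q. q \<in> U \<Longrightarrow> length q = N"
  shows "stake (N + length z) (f \<xi>) = stake (N + length z) \<xi>"
  using assms(1)
proof (induction rule: perturbations.induct)
  case (perturbations_step f p k)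
  then show "stake (N + length z) ((place (p @ z) k \<circ> f) \<xi>) = stake (N + length z) \<xi>"
    using stake_place[of "N + length z" "p @ z" k "f \<xi>"] assms(2)[of p] by simp
qed simp

lemma stream_eqI_snth: "(\<And>n. x !! n = y !! n) \<Longrightarrow> x = y"
  using stream.map_id smap_alt[of id x y] by (metis id_apply)

text \<open>Finitely many other points leave \<open>\<xi>\<close> at a bounded depth. A copy of
  \<open>t\<close> below a longer prefix of \<open>\<xi>\<close> fixes all of them and moves
  \<open>\<xi>\<close>, because \<open>t\<close> has no fixed point.\<close>

lemma perturbations_separates:
  assumes "p \<in> U" "stake (length (p @ z)) \<xi> = p @ z" "finite F" "\<xi> \<notin> F"
  shows "\<exists>k\<in>perturbations U z. (\<forall>\<eta>\<in>F. k \<eta> = \<eta>) \<and> k \<xi> \<noteq> \<xi>"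
proof -
  have "\<exists>n. \<forall>\<eta>\<in>F. \<forall>n'\<ge>n. stake n' \<eta> \<noteq> stake n' \<xi>"
    using assms(3,4)
  proof (induction F)
    case (insert \<eta> F)
    then obtain n where n: "\<And>\<eta> n'. \<eta> \<in> F \<Longrightarrow> n' \<ge> n \<Longrightarrow> stake n' \<eta> \<noteq> stake n' \<xi>" by blast
    from insert have "\<eta> \<noteq> \<xi>" by auto
    then obtain j where "\<eta> !! j \<noteq> \<xi> !! j" by (metis stream_eqI_snth)
    then have "stake n' \<eta> \<noteq> stake n' \<xi>" if "n' \<ge> Suc j" for n'
      using that by (metis Suc_le_lessD stake_nth)
    with n show ?case by (intro exI[of _ "max n (Suc j)"]) auto
  qed simp
  then obtain n where n: "\<And>\<eta> n'. \<eta> \<in> F \<Longrightarrow> n' \<ge> n \<Longrightarrow> stake n' \<eta> \<noteq> stake n' \<xi>" by blast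
  define r where "r = stake n (sdrop (length (p @ z)) \<xi>)"
  have q: "p @ z @ r = stake (length (p @ z) + n) \<xi>"
    using assms(2) unfolding r_def by (simp flip: stake_add)
  define k where "k = place (p @ z) (place r grig_t)"
  have k: "k = place (p @ z @ r) grig_t" by (simp add: k_def place_append)
  have len: "length (p @ z @ r) = length (p @ z) + n" by (simp add: r_def)
  have "k \<eta> = \<eta>" if "\<eta> \<in> F" for \<eta>
    unfolding k using n[OF that, of "length (p @ z) + n"] by (intro place_outside) (simp only: len, simp add: q)
  moreover have "\<xi> = (p @ z @ r) @- sdrop (length (p @ z) + n) \<xi>" by (simp only: q stake_sdrop)
  then obtain \<zeta> where "\<xi> = (p @ z @ r) @- \<zeta>" by blast
  then have "k \<xi> \<noteq> \<xi>" unfolding k using grig_t_neq[of \<zeta>] by (simp only: place_shift) simp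
  moreover have "k \<in> perturbations U z" unfolding k_def by (intro perturbations_place assms place_grigK grigK_grig_t)
  ultimately show ?thesis by blast
qed

section \<open>How fast generators destroy a block of zeros\<close>

definition zeros :: "nat \<Rightarrow> nat \<Rightarrow> bits \<Rightarrow> bool" where
  "zeros a b \<xi> \<longleftrightarrow> (\<forall>i. a \<le> i \<longrightarrow> i < b \<longrightarrow> \<xi> !! i = 0)"

lemma zeros_grig_a: "zeros a b \<xi> \<Longrightarrow> zeros (Suc a) b (grig_a \<xi>)"
  unfolding zeros_def grig_a_def
proof (intro allI impI)
  fix i assume *: "\<forall>i\<ge>a. i < b \<longrightarrow> \<xi> !! i = 0" "Suc a \<le> i" "i < b"
  then obtain j where "i = Suc j" by (cases i) auto
  then show "((shd \<xi> + 1) ## stl \<xi>) !! i = 0" using *(1)[rule_format, of i] *(2,3) by simp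
qed

lemma zeros_Cons: "zeros (Suc a) (Suc b) (x ## \<xi>) \<longleftrightarrow> zeros a b \<xi>"
proof
  assume z: "zeros (Suc a) (Suc b) (x ## \<xi>)"
  have "\<xi> !! i = 0" if "a \<le> i" "i < b" for i
    using z[unfolded zeros_def, rule_format, of "Suc i"] that by simp
  then show "zeros a b \<xi>" by (simp add: zeros_def)
next
  assume z: "zeros a b \<xi>"
  have "(x ## \<xi>) !! i = 0" if "Suc a \<le> i" "i < Suc b" for i
    using z[unfolded zeros_def, rule_format, of "i - 1"] that by (cases i) simp_all
  then show "zeros (Suc a) (Suc b) (x ## \<xi>)" by (simp add: zeros_def)
qed

text \<open>A letter changes at most the digit following the first zero. If the block is nonempty,
  that zero is at position \<open>a\<close> or earlier, so the change is at position
  \<open>a + 1\<close> or earlier.\<close>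

lemma zeros_grig: "zeros a b \<xi> \<Longrightarrow> zeros (a + 2) b (grig l \<xi>)"
proof (induction a arbitrary: b l \<xi>)
  case 0
  show ?case
  proof (cases "b \<le> 2")
    case False
    then obtain b' where b: "b = Suc b'" by (cases b) auto
    have "shd \<xi> = 0" using 0[unfolded zeros_def, rule_format, of 0] b by simp
    then obtain w where \<xi>: "\<xi> = 0 ## w" by (metis stream.collapse)
    have "w !! i = 0" if "i < b'" for i
      using 0[unfolded zeros_def, rule_format, of "Suc i"] that unfolding \<xi> b by simp
    then have "zeros 0 b' w" by (simp add: zeros_def)
    then have "zeros 1 b' (grig_zero l w)" using zeros_grig_a[of 0 b' w] by (cases l) (auto simp: zeros_def)
    then show ?thesis unfolding \<xi> b grig_Cons by (simp add: zeros_Cons numeral_2_eq_2)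
  qed (simp add: zeros_def)
next
  case (Suc a)
  show ?case
  proof (cases b)
    case b: (Suc b')
    show ?thesis
    proof (cases \<xi> rule: stream_bit_cases)
      case (0 w)
      then have "zeros a b' w" using Suc.prems b by (simp add: zeros_Cons)
      then have "zeros (Suc a) b' (grig_zero l w)" using zeros_grig_a[of a b' w] by (cases l) (auto simp: zeros_def)
      then have "zeros (Suc (Suc a)) b' (grig_zero l w)" by (simp add: zeros_def)
      then show ?thesis unfolding 0 b grig_Cons by (simp add: zeros_Cons)
    next
      case (1 w)
      then show ?thesis using Suc.IH[of b' w "grig_one l"] Suc.prems
        unfolding 1 b grig_Cons by (simp add: zeros_Cons)
    qed
  qed (simp add: zeros_def)
qed

lemma zeros_grig_gen: "zeros a b \<xi> \<Longrightarrow> zeros (a + 2) b (grig_gen i \<xi>)"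
  using zeros_grig_a[of a b \<xi>] zeros_grig[of a b \<xi> Letter_b] zeros_grig[of a b \<xi> Letter_c]
  by (auto simp: grig_gen_def) (simp add: zeros_def)

section \<open>Perturbed triples generate\<close>

declare place.simps(2) [simp del]

section \<open>The group generated by a triple\<close>

definition triple_group :: "(nat \<Rightarrow> bits \<Rightarrow> bits) \<Rightarrow> (bits \<Rightarrow> bits) set" where
  "triple_group X = act X ` lists ({0, 1, 2} \<times> UNIV)"

lemma inv_letter_map: "bij (X (fst l)) \<Longrightarrow> letter_map X (inv_letter l) = finv (letter_map X l)"
  by (simp add: letter_map_def inv_letter_def inv_inv_eq)

lemma triple_group_act: "w \<in> lists ({0, 1, 2} \<times> UNIV) \<Longrightarrow> act X w \<in> triple_group X"
  by (simp add: triple_group_def)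

lemma triple_group_id: "id \<in> triple_group X"
  using triple_group_act[of "[]" X] by simp

lemma triple_group_comp:
  assumes "f \<in> triple_group X" "h \<in> triple_group X" shows "f \<circ> h \<in> triple_group X"
proof -
  obtain v w where "v \<in> lists ({0, 1, 2} \<times> UNIV)" "w \<in> lists ({0, 1, 2} \<times> UNIV)" "f = act X v" "h = act X w"
    using assms by (auto simp: triple_group_def)
  then have "w @ v \<in> lists ({0, 1, 2} \<times> UNIV)" "f \<circ> h = act X (w @ v)" by (auto simp: fun_eq_iff)
  then show ?thesis by (metis triple_group_act)
qed

lemma triple_group_generator: "i \<in> {0, 1, 2} \<Longrightarrow> X i \<in> triple_group X"
  using triple_group_act[of "[(i, True)]" X] by (simp add: act_def)

lemma triple_group_fold: "W \<in> lists {0, 1, 2} \<Longrightarrow> fold X W \<in> triple_group X"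
proof (induction W)
  case Nil
  show "fold X [] \<in> triple_group X" using triple_group_id by simp
next
  case (Cons i W)
  then show "fold X (i # W) \<in> triple_group X"
    by (simp add: triple_group_comp triple_group_generator)
qed

lemma bij_letter_map: "(\<And>i. bij (X i)) \<Longrightarrow> bij (letter_map X l)"
  by (simp add: letter_map_def bij_imp_bij_inv)

lemma act_Cons: "act X (l # w) = act X w \<circ> letter_map X l"
  by (simp add: fun_eq_iff)

lemma bij_act:
  assumes "\<And>i. bij (X i)" shows "bij (act X w)"
proof (induction w)
  case (Cons l w)
  then show "bij (act X (l # w))" unfolding act_Cons by (intro bij_comp bij_letter_map assms)
qed (simp add: bij_id[unfolded id_def])

lemma inv_act:
  assumes "\<And>i. bij (X i)" shows "finv (act X w) = act X (rev (map inv_letter w))"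
proof (induction w)
  case (Cons l w)
  have "finv (act X (l # w)) = finv (letter_map X l) \<circ> finv (act X w)"
    unfolding act_Cons by (intro o_inv_distrib bij_act bij_letter_map assms)
  then show "finv (act X (l # w)) = act X (rev (map inv_letter (l # w)))"
    by (simp add: fun_eq_iff Cons inv_letter_map assms)
qed simp

lemma triple_group_inv:
  assumes "\<And>i. bij (X i)" "f \<in> triple_group X" shows "finv f \<in> triple_group X"
proof -
  obtain w where w: "w \<in> lists ({0, 1, 2} \<times> UNIV)" "f = act X w" using assms by (auto simp: triple_group_def)
  then have "rev (map inv_letter w) \<in> lists ({0, 1, 2} \<times> UNIV)" by (force simp: in_lists_conv_set inv_letter_def)
  then show ?thesis using inv_act[of X w, OF assms(1)] w(2) by (metis triple_group_act)
qed

lemma triple_group_subset: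
  assumes "\<And>i. X i \<in> grigG" shows "triple_group X \<subseteq> grigG"
proof -
  have "act X w \<in> grigG" for w
  proof (induction w)
    case Nil
    show "act X [] \<in> grigG" using grigG_id by simp
  next
    case (Cons l w)
    moreover have "letter_map X l \<in> grigG" using assms inv_grigG by (simp add: letter_map_def)
    ultimately show "act X (l # w) \<in> grigG" unfolding act_Cons by (intro grigG_comp)
  qed
  then show ?thesis by (auto simp: triple_group_def)
qed

text \<open>The end points of the Schreier graph of a level, which is a line.\<close>

definition line_start :: "nat \<Rightarrow> bit list" where "line_start N = replicate N 1"
definition line_end :: "nat \<Rightarrow> bit list" where "line_end N = replicate (N - 1) 1 @ [0]"

lemma length_line_start [simp]: "length (line_start N) = N" by (simp add: line_start_def)
lemma length_line_end: "N \<ge> 1 \<Longrightarrow> length (line_end N) = N" by (simp add: line_end_def)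

lemma grig_replicate:
  "grig l (replicate n 1 @- \<zeta>) = replicate n 1 @- grig ((grig_one ^^ n) l) \<zeta>"
  by (induction n arbitrary: l) (simp_all add: grig_Cons funpow_swap1 del: grig_letters)

lemma inj_grig_one: "inj grig_one"
proof (rule injI)
  fix l l' assume "grig_one l = grig_one l'" then show "l = l'" by (cases l; cases l') auto
qed

lemma grig_line_start: "grig l (line_start N @- \<zeta>) = line_start N @- grig ((grig_one ^^ N) l) \<zeta>"
  by (simp add: line_start_def grig_replicate)

lemma grig_line_end: "grig l (line_end N @- \<zeta>) = line_end N @- grig_zero ((grig_one ^^ (N - 1)) l) \<zeta>"
  by (simp add: line_end_def grig_replicate grig_Cons del: grig_letters)

lemma rotated_letters:
  "(grig_one ^^ n) Letter_b \<noteq> (grig_one ^^ n) Letter_c"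
  using inj_fn[OF inj_grig_one, of n] by (auto dest: injD)

text \<open>Walking along the ones rotates the letters, and only \<open>d\<close> acts trivially
  after the final \<open>0\<close>. The rotations of \<open>b\<close> and \<open>c\<close> differ,
  so one of them is not \<open>d\<close>.\<close>

lemma grig_gen_line_end: "\<exists>i\<in>{1, 2}. \<forall>\<zeta>. grig_gen i (line_end N @- \<zeta>) = line_end N @- grig_a \<zeta>"
proof -
  have "(grig_one ^^ (N - 1)) Letter_b \<noteq> Letter_d \<or> (grig_one ^^ (N - 1)) Letter_c \<noteq> Letter_d"
    using rotated_letters by metis
  moreover have "grig_zero l = grig_a" if "l \<noteq> Letter_d" for l using that by (cases l) auto
  ultimately show ?thesis using grig_line_end[of Letter_b N] grig_line_end[of Letter_c N] by auto
qed

lemma grigG_subset_if_two_letters: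
  assumes "id \<in> S" "\<And>f g. f \<in> S \<Longrightarrow> g \<in> S \<Longrightarrow> f \<circ> g \<in> S" "grig_a \<in> S"
    and "grig l \<in> S" "grig l' \<in> S" "l \<noteq> l'"
  shows "grigG \<subseteq> S"
proof -
  have "grig l \<circ> grig l' = grig (third l l')" using assms(6) by (simp add: fun_eq_iff grig_grig_third del: grig_letters)
  then have "grig (third l l') \<in> S" using assms by metis
  then have letter: "grig x \<in> S" for x
    using assms(4-6) by (cases l; cases l'; cases x) (simp_all add: third_def)
  show ?thesis
  proof
    fix g assume "g \<in> grigG"
    then show "g \<in> S" by (induction rule: grigG.induct) (blast intro: assms letter)+
  qed
qed

text \<open>\<open>(ab)\<^sup>8\<close> acts as \<open>d\<close> below \<open>00011\<close>, and the commutator of \<open>(ab)\<^sup>2\<close> with \<open>d\<close> is \<open>(ab)\<^sup>2\<close> below \<open>1\<close>.\<close>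

definition comm_left :: "bits \<Rightarrow> bits" where "comm_left = place [0, 0, 0, 1, 1] grig_t"
definition comm_right :: "bits \<Rightarrow> bits" where "comm_right = grig_t \<circ> grig_t \<circ> grig_t \<circ> grig_t"

lemma comm_left_comm_right_grigK: "comm_left \<in> grigK" "comm_right \<in> grigK"
  by (auto simp: comm_left_def comm_right_def intro!: place_grigK grigK_grig_t grigK_comp)

lemma commutator_comm_left_comm_right: "comm_left \<circ> comm_right \<circ> finv comm_left \<circ> finv comm_right = place [0, 0, 0, 1, 1, 1] grig_t"
proof -
  have "comm_right ([0, 0, 0, 1, 1] @- \<zeta>) = [0, 0, 0, 1, 1] @- grig_d \<zeta>" for \<zeta>
    by (simp add: comm_right_def grig_t_def grig_rec)
  then have "comm_right \<circ> place [0, 0, 0, 1, 1] (finv grig_t) \<circ> finv comm_right = place [0, 0, 0, 1, 1] (grig_d \<circ> finv grig_t \<circ> finv grig_d)"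
    by (intro conj_place) (auto intro: bij_grigG grigG_generators comm_left_comm_right_grigK grigK_grigG)
  then have 1: "comm_left \<circ> comm_right \<circ> finv comm_left \<circ> finv comm_right = place [0, 0, 0, 1, 1] (grig_t \<circ> (grig_d \<circ> finv grig_t \<circ> grig_d))"
    using inv_grig(2)[of Letter_d] bij_grigG[OF grig_t_grigG]
    by (simp add: comp_assoc comm_left_def inv_place place_comp)
  have 2: "grig_t \<circ> (grig_d \<circ> finv grig_t \<circ> grig_d) = place [1] grig_t"
  proof
    fix \<xi> show "(grig_t \<circ> (grig_d \<circ> finv grig_t \<circ> grig_d)) \<xi> = place [1] grig_t \<xi>"
      by (cases \<xi> rule: stream_bit_cases) (simp_all add: grig_t_inv place.simps, simp_all add: grig_t_def grig_rec grig_grig)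
  qed
  show ?thesis unfolding 1 2 by (simp flip: place_append)
qed

lemma duplicate_grigK: "k \<in> grigK \<Longrightarrow> \<exists>f\<in>grigK. \<forall>p \<zeta>. length p = n \<longrightarrow> f (p @- \<zeta>) = p @- k \<zeta>"
proof (induction n)
  case (Suc n)
  then obtain f where f: "f \<in> grigK" "\<And>p \<zeta>. length p = n \<Longrightarrow> f (p @- \<zeta>) = p @- k \<zeta>" by blast
  \<comment> \<open>A copy of \<open>f\<close> below each child of the root puts \<open>k\<close>
    below all vertices of the next level.\<close>
  have "(place [0] f \<circ> place [1] f) (p @- \<zeta>) = p @- k \<zeta>" if "length p = Suc n" for p \<zeta>
    using that f(2) by (cases p; cases "hd p") (auto simp: place.simps)
  moreover have "place [0] f \<circ> place [1] f \<in> grigK" using f(1) by (intro grigK_comp place_grigK)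
  ultimately show ?case by blast
qed auto

text \<open>Acting by \<open>t\<close> below every vertex of level \<open>M\<close> flips the digit
  at position \<open>M + 1\<close> everywhere. Below \<open>line_start N\<close> this action is some
  \<open>f'\<close> in the branching subgroup, and composing with its inverse there cancels
  it.\<close>

lemma exists_shifter:
  assumes "M \<ge> N"
  shows "\<exists>g\<in>grigK. (\<forall>\<zeta>. g (line_start N @- \<zeta>) = line_start N @- \<zeta>) \<and> (\<forall>\<xi>. stake N \<xi> \<noteq> line_start N \<longrightarrow> g \<xi> !! Suc M = \<xi> !! Suc M + 1)"
proof -
  obtain f where f: "f \<in> grigK" "\<And>p \<zeta>. length p = M \<Longrightarrow> f (p @- \<zeta>) = p @- grig_t \<zeta>"
    using duplicate_grigK[OF grigK_grig_t] by blast
  obtain f' where f': "f' \<in> grigK" "\<And>p \<zeta>. length p = M - N \<Longrightarrow> f' (p @- \<zeta>) = p @- grig_t \<zeta>"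
    using duplicate_grigK[OF grigK_grig_t] by blast
  have ff': "f (line_start N @- \<zeta>) = line_start N @- f' \<zeta>" for \<zeta>
  proof -
    obtain p \<zeta>' where \<zeta>: "\<zeta> = p @- \<zeta>'" "length p = M - N" by (metis length_stake stake_sdrop)
    then show ?thesis using f(2)[of "line_start N @ p" \<zeta>'] f'(2)[of p \<zeta>'] assms by simp
  qed
  let ?g = "f \<circ> place (line_start N) (finv f')"
  have bij: "bij f'" using f' bij_grigG grigK_grigG by blast
  have "?g (line_start N @- \<zeta>) = line_start N @- \<zeta>" for \<zeta>
    using bij by (simp add: ff' bij_is_surj surj_f_inv_f)
  moreover have "?g \<xi> !! Suc M = \<xi> !! Suc M + 1" if "stake N \<xi> \<noteq> line_start N" for \<xi>
  proof -
    have "?g \<xi> = f \<xi>" using that by (simp add: place_outside)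
    also have "\<dots> = stake M \<xi> @- grig_t (sdrop M \<xi>)" using f(2)[of "stake M \<xi>" "sdrop M \<xi>"] by (simp add: stake_sdrop)
    finally have "?g \<xi> !! Suc M = grig_t (sdrop M \<xi>) !! 1" by (simp only: shift_snth_ge) simp
    also have "\<dots> = sdrop M \<xi> !! 1 + 1" by (rule grig_t_snth)
    also have "sdrop M \<xi> !! 1 = \<xi> !! Suc M" by (simp only: sdrop_snth) simp
    finally show ?thesis .
  qed
  moreover have "?g \<in> grigK" using f(1) f'(1) by (intro grigK_comp place_grigK inv_grigK)
  ultimately show ?thesis by blast
qed

text \<open>
  The words \<open>WA\<close>, \<open>WB\<close>, \<open>WC\<close> are chosen before \<open>m\<close>: evaluated at the perturbed generators, \<open>WA\<close> and \<open>WB\<close>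
  deviate from their original values only on points that vanish from position \<open>M\<close> up to \<open>N + m\<close>, and
  \<open>WC\<close> changes the digit at position \<open>M + 1\<close>.
\<close>

locale perturbed_triple =
  fixes N m :: nat and k :: "nat \<Rightarrow> bits \<Rightarrow> bits" and WA WB WC :: "nat list" and M :: nat
    and X :: "nat \<Rightarrow> bits \<Rightarrow> bits"
  defines "M \<equiv> N + 2 * max (length WA) (length WB)"
    and "X \<equiv> \<lambda>i. grig_gen i \<circ> k i"
  assumes N: "N \<ge> 1"
    and k: "\<And>i. k i \<in> perturbations {p. length p = N} (replicate m 0)"
    and ku: "\<And>i \<zeta>. i \<in> {1, 2} \<Longrightarrow> k i (line_start N @- \<zeta>) = line_start N @- \<zeta>"
    and kv: "\<And>i \<zeta>. i \<in> {1, 2} \<Longrightarrow> k i (line_end N @- \<zeta>) = line_end N @- \<zeta>"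
    and connect: "\<exists>W\<in>lists {0, 1, 2}. \<forall>\<zeta>. fold X W (line_start N @- \<zeta>) = line_end N @- \<zeta>"
    and WA: "WA \<in> lists {0, 1, 2}" "fold grig_gen WA = place (line_start N) comm_left"
    and WB: "WB \<in> lists {0, 1, 2}" "fold grig_gen WB = place (line_start N) comm_right"
    and WC: "WC \<in> lists {0, 1, 2}" "\<And>\<zeta>. fold grig_gen WC (line_start N @- \<zeta>) = line_start N @- \<zeta>"
      "\<And>\<xi>. stake N \<xi> \<noteq> line_start N \<Longrightarrow> fold grig_gen WC \<xi> !! Suc M = \<xi> !! Suc M + 1"
    and m: "m \<ge> 14" "Suc M < N + m"
begin

abbreviation "H \<equiv> triple_group X"
abbreviation "u \<equiv> line_start N"

lemma k_grigG: "k i \<in> grigG" using k perturbations_grigK grigK_grigG by blast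

lemma X_grigG: "X i \<in> grigG" unfolding X_def by (intro grigG_comp grig_gen_grigG k_grigG)

lemma bij_X: "bij (X i)" using X_grigG bij_grigG by blast

lemma H_grigG: "h \<in> H \<Longrightarrow> h \<in> grigG" using triple_group_subset[of X] X_grigG by blast

lemma H_inv: "h \<in> H \<Longrightarrow> finv h \<in> H" by (rule triple_group_inv[OF bij_X])

lemmas H_comp = triple_group_comp[of _ X]

lemma bij_H: "h \<in> H \<Longrightarrow> bij h" using H_grigG bij_grigG by blast

text \<open>The sections at \<open>u\<close> of elements of \<open>H\<close> fixing \<open>u\<close>
  contain \<open>a\<close>, by walking to the other end, applying the generator that acts as
  \<open>a\<close> there and walking back. They contain two of the letters through
  \<open>X 1\<close> and \<open>X 2\<close>, which are unperturbed at \<open>u\<close>.\<close>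

lemma section_is_grigG:
  assumes "g \<in> grigG" shows "\<exists>h\<in>H. \<forall>\<zeta>. h (u @- \<zeta>) = u @- g \<zeta>"
proof -
  define S where "S = {g. \<exists>h\<in>H. \<forall>\<zeta>. h (u @- \<zeta>) = u @- g \<zeta>}"
  have "id \<in> S" using triple_group_id[of X] by (auto simp: S_def intro!: bexI[of _ id])
  moreover have "f \<circ> g \<in> S" if "f \<in> S" "g \<in> S" for f g
  proof -
    obtain h h' where "h \<in> H" "h' \<in> H" "\<And>\<zeta>. h (u @- \<zeta>) = u @- f \<zeta>" "\<And>\<zeta>. h' (u @- \<zeta>) = u @- g \<zeta>"
      using \<open>f \<in> S\<close> \<open>g \<in> S\<close> by (auto simp: S_def)
    then have "h \<circ> h' \<in> H" "\<forall>\<zeta>. (h \<circ> h') (u @- \<zeta>) = u @- (f \<circ> g) \<zeta>" by (auto intro: H_comp)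
    then show ?thesis unfolding S_def by blast
  qed
  moreover have "grig_a \<in> S"
  proof -
    obtain W where W: "W \<in> lists {0, 1, 2}" "\<And>\<zeta>. fold X W (u @- \<zeta>) = line_end N @- \<zeta>" using connect by blast
    obtain i where i: "i \<in> {1, 2}" "\<And>\<zeta>. grig_gen i (line_end N @- \<zeta>) = line_end N @- grig_a \<zeta>" using grig_gen_line_end by blast
    define w where "w = fold X W"
    have w: "w \<in> H" "\<And>\<zeta>. w (u @- \<zeta>) = line_end N @- \<zeta>"
      using W triple_group_fold by (auto simp: w_def)
    then have inv_w: "finv w (line_end N @- \<zeta>) = u @- \<zeta>" for \<zeta>
      by (metis bij_H bij_is_inj inv_f_f)
    have "finv w \<circ> X i \<circ> w \<in> H" using i(1) w by (auto intro!: H_comp H_inv triple_group_generator)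
    moreover have "(finv w \<circ> X i \<circ> w) (u @- \<zeta>) = u @- grig_a \<zeta>" for \<zeta>
      using kv[OF i(1)] by (simp add: w inv_w X_def i(2))
    ultimately show ?thesis unfolding S_def by blast
  qed
  moreover have "grig ((grig_one ^^ N) Letter_b) \<in> S" "grig ((grig_one ^^ N) Letter_c) \<in> S"
  proof -
    have "X 1 (u @- \<zeta>) = u @- grig ((grig_one ^^ N) Letter_b) \<zeta>" for \<zeta>
      using ku[of 1] grig_line_start[of Letter_b N] by (simp add: X_def)
    moreover have "X 1 \<in> H" by (rule triple_group_generator) simp
    ultimately show "grig ((grig_one ^^ N) Letter_b) \<in> S" unfolding S_def by blast
    have "X 2 (u @- \<zeta>) = u @- grig ((grig_one ^^ N) Letter_c) \<zeta>" for \<zeta>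
      using ku[of 2] grig_line_start[of Letter_c N] by (simp add: X_def)
    moreover have "X 2 \<in> H" by (rule triple_group_generator) simp
    ultimately show "grig ((grig_one ^^ N) Letter_c) \<in> S" unfolding S_def by blast
  qed
  ultimately have "grigG \<subseteq> S" using rotated_letters by (rule grigG_subset_if_two_letters)
  then show ?thesis using assms unfolding S_def by blast
qed

lemma X_stake: "stake (N + m) (X i \<xi>) = stake (N + m) (grig_gen i \<xi>)"
proof -
  have "stake (N + length (replicate m (0::bit))) (k i \<xi>) = stake (N + length (replicate m (0::bit))) \<xi>"
    by (rule perturbations_stake[OF k]) blast
  then have "stake (N + m) (k i \<xi>) = stake (N + m) \<xi>" by (simp only: length_replicate)
  then have "stake (N + m) (grig_gen i (k i \<xi>)) = stake (N + m) (grig_gen i \<xi>)"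
    by (rule grigG_stake[OF grig_gen_grigG])
  then show ?thesis by (simp only: X_def comp_apply)
qed

lemma fold_X_stake: "stake (N + m) (fold X W \<xi>) = stake (N + m) (fold grig_gen W \<xi>)"
proof (induction W arbitrary: \<xi>)
  case (Cons i W)
  then show ?case using grigG_stake[OF fold_grig_gen_grigG X_stake] by simp
qed simp

text \<open>When a perturbation first moves the current point, that point has zeros from
  \<open>N\<close> up to \<open>N + m\<close>. Undoing each earlier generator costs at most two
  positions at the start of the block.\<close>

lemma fold_X_moved:
  "fold X W \<xi> \<noteq> fold grig_gen W \<xi> \<Longrightarrow> zeros (N + 2 * length W) (N + m) \<xi>"
proof (induction W arbitrary: \<xi>)
  case (Cons i W)
  show ?case
  proof (cases "k i \<xi> = \<xi>")
    case True
    then have "zeros (N + 2 * length W) (N + m) (grig_gen i \<xi>)"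
      using Cons by (simp add: X_def)
    then show ?thesis using zeros_grig_gen[of "N + 2 * length W" "N + m" "grig_gen i \<xi>" i]
      by (simp add: add.commute add.left_commute)
  next
    case False
    then obtain p where p: "length p = N" "stake (N + m) \<xi> = p @ replicate m 0"
      using perturbations_moved[OF k] by fastforce
    have "\<xi> !! i = 0" if "N \<le> i" "i < N + m" for i
    proof -
      have "\<xi> !! i = stake (N + m) \<xi> ! i" using that by simp
      then show ?thesis using that p by (simp add: nth_append)
    qed
    then show ?thesis by (simp add: zeros_def)
  qed
qed simp

section \<open>The three words evaluated at the perturbed generators\<close>

definition "A = fold X WA"
definition "B = fold X WB"
definition "C = fold X WC"

lemma words_H: "A \<in> H" "B \<in> H" "C \<in> H"
  unfolding A_def B_def C_def by (intro triple_group_fold WA WB WC)+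

lemma stake_le: "stake (N + m) \<xi> = stake (N + m) \<eta> \<Longrightarrow> n \<le> N + m \<Longrightarrow> stake n \<xi> = stake n \<eta>"
  by (metis min.absorb1 take_stake)

lemma AB_outside:
  assumes "stake N \<xi> \<noteq> u"
  shows "A \<xi> \<noteq> \<xi> \<Longrightarrow> \<xi> !! Suc M = 0" "B \<xi> \<noteq> \<xi> \<Longrightarrow> \<xi> !! Suc M = 0"
proof -
  have *: "\<xi> !! Suc M = 0" if "fold X W \<xi> \<noteq> \<xi>" "fold grig_gen W = place u f" "N + 2 * length W \<le> M" for W f
  proof -
    \<comment> \<open>Outside the cone of \<open>u\<close> the unperturbed word is trivial, so any
      motion there is a deviation and forces the block of zeros, which contains position
      \<open>M + 1\<close>.\<close>
    have "fold grig_gen W \<xi> = \<xi>" using that(2) assms by (simp add: place_outside)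
    then have "zeros (N + 2 * length W) (N + m) \<xi>" using that(1) by (intro fold_X_moved) simp
    then show ?thesis using that(3) m(2) by (simp add: zeros_def del: snth.simps)
  qed
  show "A \<xi> \<noteq> \<xi> \<Longrightarrow> \<xi> !! Suc M = 0" unfolding A_def by (rule *[OF _ WA(2)]) (simp_all add: M_def)
  show "B \<xi> \<noteq> \<xi> \<Longrightarrow> \<xi> !! Suc M = 0" unfolding B_def by (rule *[OF _ WB(2)]) (simp_all add: M_def)
qed

lemma in_cone_iff: "stake N \<xi> = u \<longleftrightarrow> (\<exists>\<zeta>. \<xi> = u @- \<zeta>)"
proof
  assume "stake N \<xi> = u"
  then have "\<xi> = u @- sdrop N \<xi>" by (metis stake_sdrop)
  then show "\<exists>\<zeta>. \<xi> = u @- \<zeta>" by blast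
qed (auto simp: stake_shift)

lemma stake_AB: "stake N (A \<xi>) = stake N \<xi>" "stake N (B \<xi>) = stake N \<xi>"
  using stake_le[OF fold_X_stake, of N WA \<xi>] stake_le[OF fold_X_stake, of N WB \<xi>] stake_place[of N u]
  by (simp_all add: A_def B_def WA WB)

lemma stake_C: "stake N (C \<xi>) = u \<longleftrightarrow> stake N \<xi> = u"
proof -
  have "stake N (C \<xi>) = stake N (fold grig_gen WC \<xi>)"
    using stake_le[OF fold_X_stake, of N WC \<xi>] by (simp add: C_def)
  moreover have "inj (fold grig_gen WC)" using bij_grigG fold_grig_gen_grigG bij_is_inj by blast
  moreover have "stake N (fold grig_gen WC \<xi>) = u \<longleftrightarrow> stake N \<xi> = u"
  proof
    assume "stake N (fold grig_gen WC \<xi>) = u"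
    then obtain \<zeta> where "fold grig_gen WC \<xi> = u @- \<zeta>" by (auto simp: in_cone_iff)
    then have "fold grig_gen WC \<xi> = fold grig_gen WC (u @- \<zeta>)" by (simp only: WC(2))
    then have "\<xi> = u @- \<zeta>" using calculation(2) by (rule injD[rotated])
    then show "stake N \<xi> = u" by (simp add: stake_shift)
  next
    assume "stake N \<xi> = u"
    then obtain \<zeta> where "\<xi> = u @- \<zeta>" by (auto simp: in_cone_iff)
    then show "stake N (fold grig_gen WC \<xi>) = u" by (simp add: WC(2) stake_shift)
  qed
  ultimately show ?thesis by simp
qed

lemma C_shifts: "stake N \<xi> \<noteq> u \<Longrightarrow> C \<xi> !! Suc M = \<xi> !! Suc M + 1"
proof -
  assume "stake N \<xi> \<noteq> u"
  moreover have "stake (N + m) (C \<xi>) ! Suc M = stake (N + m) (fold grig_gen WC \<xi>) ! Suc M"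
    by (simp only: fold_X_stake C_def)
  ultimately show ?thesis using WC(3) m(2) by (simp del: snth.simps)
qed

end

text \<open>Injective maps with disjoint supports in \<open>S\<close> commute on \<open>S\<close>: a
  point moved by one of them stays in its support and is fixed by the other.\<close>

lemma commute_outside:
  assumes "inj f" "inj g"
    and f: "\<And>x. x \<in> S \<Longrightarrow> f x \<in> S" and g: "\<And>x. x \<in> S \<Longrightarrow> g x \<in> S"
    and dis: "\<And>x. x \<in> S \<Longrightarrow> f x = x \<or> g x = x" and x: "x \<in> S"
  shows "f (g x) = g (f x)"
proof (cases "g x = x")
  case True
  show ?thesis
  proof (cases "f x = x")
    case False
    then have "f (f x) \<noteq> f x" using assms(1) by (simp add: inj_eq)
    then show ?thesis using dis[OF f[OF x]] True by simp
  qed (use True in simp)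
next
  case False
  then have "g (g x) \<noteq> g x" using assms(2) by (simp add: inj_eq)
  then show ?thesis using dis[OF g[OF x]] dis[OF x] False by simp
qed

text \<open>Congruence modulo the stabiliser of level \<open>n\<close>.\<close>

definition grigG_cong :: "nat \<Rightarrow> (bits \<Rightarrow> bits) \<Rightarrow> (bits \<Rightarrow> bits) \<Rightarrow> bool" where
  "grigG_cong n f g \<longleftrightarrow> f \<in> grigG \<and> g \<in> grigG \<and> (\<forall>\<xi>. stake n (f \<xi>) = stake n (g \<xi>))"

lemma grigG_cong_comp:
  assumes "grigG_cong n f g" "grigG_cong n f' g'" shows "grigG_cong n (f \<circ> f') (g \<circ> g')"
proof -
  have "stake n (f (f' \<xi>)) = stake n (g (g' \<xi>))" for \<xi>
  proof -
    have "stake n (f (f' \<xi>)) = stake n (f (g' \<xi>))"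
      by (rule grigG_stake) (use assms in \<open>auto simp: grigG_cong_def\<close>)
    then show ?thesis using assms by (simp add: grigG_cong_def)
  qed
  then show ?thesis using assms by (simp add: grigG_cong_def grigG_comp)
qed

lemma grigG_cong_inv:
  assumes "grigG_cong n f g" shows "grigG_cong n (finv f) (finv g)"
proof -
  have grigG: "f \<in> grigG" "g \<in> grigG" using assms by (auto simp: grigG_cong_def)
  have "stake n (finv f \<xi>) = stake n (finv g \<xi>)" for \<xi>
  proof -
    have "stake n (f (finv g \<xi>)) = stake n \<xi>"
      using assms bij_is_surj[OF bij_grigG[OF grigG(2)]] by (simp add: grigG_cong_def surj_f_inv_f)
    then have "stake n (finv f (f (finv g \<xi>))) = stake n (finv f \<xi>)"
      by (rule grigG_stake[OF inv_grigG[OF grigG(1)]])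
    then show ?thesis using bij_is_inj[OF bij_grigG[OF grigG(1)]] by (simp add: inv_f_f)
  qed
  then show ?thesis using grigG inv_grigG by (simp add: grigG_cong_def)
qed

text \<open>Since \<open>n\<close> moves the vertex \<open>v\<close>, the conjugate of \<open>F\<^sup>-\<^sup>1\<close> by \<open>n\<close> is trivial below \<open>v\<close>, so \<open>c\<close> acts there as \<open>F\<close>.\<close>

lemma double_commutator:
  fixes n f f' :: "bits \<Rightarrow> bits"
  assumes bij: "bij n" "bij f" "bij f'" and n: "\<And>\<zeta>. stake (length v) (n (v @- \<zeta>)) \<noteq> v"
    and F: "F = place v f" "F' = place v f'" and c: "c = F \<circ> n \<circ> finv F \<circ> finv n"
  shows "c \<circ> F' \<circ> finv c \<circ> finv F' = place v (f \<circ> f' \<circ> finv f \<circ> finv f')"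
proof -
  have bijF: "bij F" "bij F'" and invF: "finv F = place v (finv f)" "finv F' = place v (finv f')"
    using bij inv_place by (auto simp: F)
  define e where "e = n \<circ> finv F \<circ> finv n"
  have bij_e: "bij e" unfolding e_def by (intro bij_comp bij_imp_bij_inv bij bijF)
  have e: "e (v @- \<zeta>) = v @- \<zeta>" for \<zeta>
  proof -
    let ?\<eta> = "finv n (v @- \<zeta>)"
    have n_eta: "n ?\<eta> = v @- \<zeta>" using bij(1) by (simp add: bij_is_surj surj_f_inv_f)
    have "stake (length v) ?\<eta> \<noteq> v"
    proof
      assume "stake (length v) ?\<eta> = v"
      then have "?\<eta> = v @- sdrop (length v) ?\<eta>" by (metis stake_sdrop)
      then have "stake (length v) (n ?\<eta>) \<noteq> v" using n by metis
      then show False by (simp add: n_eta stake_shift)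
    qed
    then show ?thesis by (simp add: e_def invF place_outside n_eta)
  qed
  have inv_e: "finv e (v @- \<zeta>) = v @- \<zeta>" for \<zeta>
    using e[of \<zeta>] bij_is_inj[OF bij_e] by (metis inv_f_f)
  have inv_e_outside: "stake (length v) (finv e \<xi>) \<noteq> v" if "stake (length v) \<xi> \<noteq> v" for \<xi>
  proof
    assume "stake (length v) (finv e \<xi>) = v"
    then have "finv e \<xi> = v @- sdrop (length v) (finv e \<xi>)" by (metis stake_sdrop)
    then have "e (finv e \<xi>) = v @- sdrop (length v) (finv e \<xi>)" using e by metis
    then have "\<xi> = v @- sdrop (length v) (finv e \<xi>)" using bij_e by (simp add: bij_is_surj surj_f_inv_f)
    then have "stake (length v) \<xi> = stake (length v) (v @- sdrop (length v) (finv e \<xi>))" by simp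
    then show False using that by (simp add: stake_shift)
  qed
  have c': "c = F \<circ> e" "finv c = finv e \<circ> finv F"
    using o_inv_distrib[OF bijF(1) bij_e] by (simp_all add: c e_def comp_assoc)
  show ?thesis
  proof (rule fun_eq_by_vertex[of _ v])
    fix \<zeta>
    show "(c \<circ> F' \<circ> finv c \<circ> finv F') (v @- \<zeta>) = place v (f \<circ> f' \<circ> finv f \<circ> finv f') (v @- \<zeta>)"
      unfolding c'(2) unfolding c'(1) by (simp add: inv_e invF) (simp add: F e)
  next
    fix \<xi> assume out: "stake (length v) \<xi> \<noteq> v"
    have "F' (finv e \<xi>) = finv e \<xi>" using inv_e_outside[OF out] by (simp add: F place_outside)
    then show "(c \<circ> F' \<circ> finv c \<circ> finv F') \<xi> = place v (f \<circ> f' \<circ> finv f \<circ> finv f') \<xi>"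
      unfolding c'(2) unfolding c'(1)
      using out bij_e by (simp add: invF place_outside) (simp add: F place_outside bij_is_surj surj_f_inv_f)
  qed
qed

context perturbed_triple
begin

section \<open>An element of \<open>H\<close> supported below \<open>u\<close>\<close>

definition "B' = C \<circ> B \<circ> finv C"
definition "rigid = A \<circ> B' \<circ> finv A \<circ> finv B'"

lemma B'_H: "B' \<in> H" unfolding B'_def by (intro H_comp words_H H_inv)

lemma rigid_H: "rigid \<in> H" unfolding rigid_def by (intro H_comp words_H H_inv B'_H)

lemma inv_cone: "bij h \<Longrightarrow> (\<And>\<xi>. stake N (h \<xi>) = u \<longleftrightarrow> stake N \<xi> = u) \<Longrightarrow> stake N (finv h \<xi>) = u \<longleftrightarrow> stake N \<xi> = u"
  by (metis bij_is_surj surj_f_inv_f)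

lemma cone_preserved:
  "stake N (A \<xi>) = u \<longleftrightarrow> stake N \<xi> = u" "stake N (B' \<xi>) = u \<longleftrightarrow> stake N \<xi> = u"
  "stake N (finv C \<xi>) = u \<longleftrightarrow> stake N \<xi> = u"
  using stake_AB inv_cone[OF bij_H[OF words_H(3)] stake_C] stake_C by (simp_all add: B'_def)

lemma rigid_outside:
  assumes "stake N \<xi> \<noteq> u" shows "rigid \<xi> = \<xi>"
proof -
  let ?S = "{\<xi>. stake N \<xi> \<noteq> u}"
  \<comment> \<open>Outside the cone, \<open>A\<close> and \<open>B\<close> move only points with
    digit \<open>0\<close> at position \<open>M + 1\<close>. Conjugation by \<open>C\<close> turns
    this digit into \<open>1\<close> for \<open>B'\<close>, so the supports are disjoint.\<close>
  have dis: "A \<xi> = \<xi> \<or> B' \<xi> = \<xi>" if "\<xi> \<in> ?S" for \<xi>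
  proof (rule ccontr)
    assume neq: "\<not> (A \<xi> = \<xi> \<or> B' \<xi> = \<xi>)"
    let ?\<eta> = "finv C \<xi>"
    have C: "C ?\<eta> = \<xi>" using bij_H[OF words_H(3)] by (simp add: bij_is_surj surj_f_inv_f)
    have \<eta>: "stake N ?\<eta> \<noteq> u" using that cone_preserved(3) by simp
    have "B ?\<eta> \<noteq> ?\<eta>" using neq C by (auto simp: B'_def)
    then have "?\<eta> !! Suc M = 0" by (rule AB_outside(2)[OF \<eta>])
    then have "\<xi> !! Suc M = 1" using C_shifts[OF \<eta>] C by simp
    moreover have "\<xi> !! Suc M = 0" using AB_outside(1)[of \<xi>] that neq by blast
    ultimately show False by simp
  qed
  have bij: "bij A" "bij B'" using bij_H words_H B'_H by blast+
  \<comment> \<open>With this choice \<open>rigid \<xi>\<close> is \<open>A (B' ?\<eta>)\<close>,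
    while \<open>\<xi>\<close> is \<open>B' (A ?\<eta>)\<close>.\<close>
  let ?\<eta> = "finv A (finv B' \<xi>)"
  have "?\<eta> \<in> ?S" using assms inv_cone[OF bij(1) cone_preserved(1)] inv_cone[OF bij(2) cone_preserved(2)] by simp
  then have "A (B' ?\<eta>) = B' (A ?\<eta>)"
    using bij cone_preserved dis by (intro commute_outside[of A B' ?S]) (auto simp: bij_is_inj)
  then show ?thesis using bij by (simp add: rigid_def bij_is_surj surj_f_inv_f)
qed

abbreviation "L \<equiv> N + m"

lemma fold_cong: "grigG_cong L (fold X W) (fold grig_gen W)" if "W \<in> lists {0, 1, 2}"
  using fold_X_stake fold_grig_gen_grigG H_grigG triple_group_fold[OF that] by (simp add: grigG_cong_def)

text \<open>Down to level \<open>L\<close> the perturbations are invisible. There \<open>C\<close>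
  is trivial below \<open>u\<close>, and \<open>rigid\<close> is the commutator of
  \<open>comm_left\<close> with \<open>comm_right\<close>; in particular it is not trivial.\<close>

lemma rigid_cong: "grigG_cong L rigid (place u (place [0, 0, 0, 1, 1, 1] grig_t))"
proof -
  define c where "c = fold grig_gen WC"
  have c: "grigG_cong L C c" using fold_cong[OF WC(1)] by (simp add: C_def c_def)
  have a: "grigG_cong L A (place u comm_left)" using fold_cong[OF WA(1)] WA(2) by (simp add: A_def)
  have b: "grigG_cong L B (place u comm_right)" using fold_cong[OF WB(1)] WB(2) by (simp add: B_def)
  have bij: "bij comm_left" "bij comm_right" using comm_left_comm_right_grigK grigK_grigG bij_grigG by blast+
  have "bij c" using c bij_grigG by (simp add: grigG_cong_def)
  then have "c \<circ> place u comm_right \<circ> finv c = place u (id \<circ> comm_right \<circ> finv id)"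
    using WC(2) by (intro conj_place) (simp_all add: c_def)
  then have "grigG_cong L B' (place u comm_right)"
    using grigG_cong_comp[OF grigG_cong_comp[OF c b] grigG_cong_inv[OF c]] by (simp add: B'_def)
  then have "grigG_cong L rigid (place u comm_left \<circ> place u comm_right \<circ> finv (place u comm_left) \<circ> finv (place u comm_right))"
    unfolding rigid_def using a by (intro grigG_cong_comp grigG_cong_inv)
  moreover have "place u comm_left \<circ> place u comm_right \<circ> finv (place u comm_left) \<circ> finv (place u comm_right)
      = place u (place [0, 0, 0, 1, 1, 1] grig_t)"
    unfolding commutator_comm_left_comm_right[symmetric] using bij by (simp add: place_comp inv_place)
  ultimately show ?thesis by simp
qed

text \<open>To this depth \<open>rigid\<close> acts below \<open>u\<close> as \<open>t\<close> below
  \<open>000111\<close>. As \<open>t\<close> flips a second digit, this vertex is sent to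
  \<open>00011101\<close>.\<close>

abbreviation "v0 \<equiv> [0, 0, 0, 1, 1, 1, 0, 0 :: bit]"

lemma rigid_section:
  "\<exists>n'\<in>grigG. rigid = place u n' \<and> (\<forall>\<zeta>. stake (length v0) (n' (v0 @- \<zeta>)) \<noteq> v0)"
proof -
  have rigid_stake: "stake L (rigid \<xi>) = stake L (place u (place [0, 0, 0, 1, 1, 1] grig_t) \<xi>)" for \<xi>
    using rigid_cong by (simp add: grigG_cong_def)
  obtain q n' where q: "length q = N" "n' \<in> grigG" "\<And>\<zeta>. rigid (u @- \<zeta>) = q @- n' \<zeta>"
    using grigG_section[OF H_grigG[OF rigid_H], of u] by auto
  have "q = stake N (rigid (u @- undefined))" using q by (simp add: stake_shift)
  also have "\<dots> = stake N (place u (place [0, 0, 0, 1, 1, 1] grig_t) (u @- undefined))"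
    by (rule stake_le[OF rigid_stake]) simp
  finally have "q = u" by (simp add: stake_shift)
  then have "rigid = place u n'" using q(3) rigid_outside by (intro fun_eq_by_vertex[of _ u]) (simp_all add: place_outside)
  moreover have "stake (length v0) (n' (v0 @- \<zeta>)) \<noteq> v0" for \<zeta>
  proof -
    have "stake (N + 8) (rigid (u @- v0 @- \<zeta>)) = stake (N + 8) (place u (place [0, 0, 0, 1, 1, 1] grig_t) (u @- v0 @- \<zeta>))"
      by (rule stake_le[OF rigid_stake]) (use m in simp)
    then have "stake 8 (n' (v0 @- \<zeta>)) = stake 8 (place [0, 0, 0, 1, 1, 1] grig_t (v0 @- \<zeta>))"
      using q(3) \<open>q = u\<close> by (simp add: stake_shift)
    also have "\<dots> = [0, 0, 0, 1, 1, 1, 0, 1]"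
      by (simp add: place.simps grig_t_def grig_rec numeral_eq_Suc)
    finally show ?thesis by (simp add: numeral_eq_Suc)
  qed
  ultimately show ?thesis using q(2) by blast
qed

section \<open>The maps whose copies below \<open>u\<close> lie in \<open>H\<close>\<close>

definition "Q = {f. place u f \<in> H}"

lemma Q_comp: "f \<in> Q \<Longrightarrow> g \<in> Q \<Longrightarrow> f \<circ> g \<in> Q"
  by (simp add: Q_def place_comp H_comp)

lemma Q_inv: "bij f \<Longrightarrow> f \<in> Q \<Longrightarrow> finv f \<in> Q"
  using H_inv[of "place u f"] by (simp add: Q_def inv_place)

text \<open>Every element of \<open>grigG\<close> is the section at \<open>u\<close> of an element
  of \<open>H\<close>, and conjugating by the latter stays inside \<open>H\<close>.\<close>

lemma Q_conj:
  assumes "f \<in> Q" "g \<in> grigG" shows "g \<circ> f \<circ> finv g \<in> Q"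
proof -
  obtain h where h: "h \<in> H" "\<And>\<zeta>. h (u @- \<zeta>) = u @- g \<zeta>" using section_is_grigG[OF assms(2)] by blast
  have "h \<circ> place u f \<circ> finv h = place u (g \<circ> f \<circ> finv g)"
    using h(1) assms(2) by (intro conj_place h(2) bij_H bij_grigG) simp_all
  moreover have "h \<circ> place u f \<circ> finv h \<in> H" using assms h(1) by (intro H_comp H_inv) (auto simp: Q_def)
  ultimately show ?thesis by (simp add: Q_def)
qed

text \<open>The commutator of \<open>comm_left\<close> and \<open>comm_right\<close>, both placed
  below \<open>v0\<close>, is \<open>t\<close> below this vertex. Its length \<open>14\<close> is
  the bound imposed on \<open>m\<close>.\<close>

abbreviation "w0 \<equiv> v0 @ [0, 0, 0, 1, 1, 1]"

lemma place_grig_t_Q: "place w0 grig_t \<in> Q"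
proof -
  obtain n' where n': "n' \<in> grigG" "rigid = place u n'" "\<And>\<zeta>. stake (length v0) (n' (v0 @- \<zeta>)) \<noteq> v0"
    using rigid_section by blast
  have nQ: "n' \<in> Q" using rigid_H n'(2) by (simp add: Q_def)
  have bij: "bij n'" "bij comm_left" "bij comm_right" using n'(1) comm_left_comm_right_grigK grigK_grigG bij_grigG by blast+
  define F where "F = place v0 comm_left"
  define F' where "F' = place v0 comm_right"
  have grigG: "F \<in> grigG" "F' \<in> grigG" unfolding F_def F'_def by (intro grigK_grigG place_grigK comm_left_comm_right_grigK)+
  define c where "c = F \<circ> n' \<circ> finv F \<circ> finv n'"
  \<comment> \<open>\<open>F\<close> is only known to be in \<open>grigG\<close>; its conjugate of
    \<open>n'\<close> is in \<open>Q\<close> by normality. The next commutator, with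
    \<open>F'\<close>, is treated in the same way.\<close>
  have cQ: "c \<in> Q" unfolding c_def using nQ bij grigG by (intro Q_comp[of _ "finv n'"] Q_conj Q_inv)
  have "c \<in> grigG" unfolding c_def by (intro grigG_comp inv_grigG n' grigG)
  then have "c \<circ> (F' \<circ> finv c \<circ> finv F') \<in> Q" by (intro Q_comp Q_conj Q_inv cQ grigG bij_grigG)
  moreover have "c \<circ> (F' \<circ> finv c \<circ> finv F') = place v0 (place [0, 0, 0, 1, 1, 1] grig_t)"
    using double_commutator[OF bij n'(3) F_def F'_def c_def] unfolding commutator_comm_left_comm_right by (simp add: comp_assoc)
  ultimately show ?thesis by (simp only: place_append)
qed

text \<open>Conjugation by a generator below \<open>w0\<close> is realised by an element of
  \<open>grigG\<close> fixing \<open>w0\<close> with that section, and \<open>Q\<close> is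
  normalised by \<open>grigG\<close>.\<close>

lemma place_Q: "\<kappa> \<in> grigK \<Longrightarrow> place w0 \<kappa> \<in> Q"
proof (induction rule: grigK.induct)
  case grigK_id
  show "place w0 id \<in> Q" using triple_group_id by (simp add: Q_def)
next
  case grigK_grig_t
  show ?case by (rule place_grig_t_Q)
next
  case (grigK_comp f g)
  then show "place w0 (f \<circ> g) \<in> Q" unfolding place_comp by (intro Q_comp)
next
  case (grigK_conj_a \<kappa>)
  obtain h where h: "h \<in> grigG" "\<And>\<zeta>. h (w0 @- \<zeta>) = w0 @- grig_a \<zeta>" using grigG_lift[OF grigG_generators(1)] by blast
  have "h \<circ> place w0 \<kappa> \<circ> finv h = place w0 (grig_a \<circ> \<kappa> \<circ> finv grig_a)"
    by (intro conj_place h(2) bij_grigG h(1) grigG_generators) simp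
  then show "place w0 (grig_a \<circ> \<kappa> \<circ> grig_a) \<in> Q" using Q_conj[OF grigK_conj_a.IH h(1)] by (simp only: inv_grig)
next
  case (grigK_conj_l \<kappa> l)
  obtain h where h: "h \<in> grigG" "\<And>\<zeta>. h (w0 @- \<zeta>) = w0 @- grig l \<zeta>" using grigG_lift[OF grigG_generators(2)] by blast
  have "h \<circ> place w0 \<kappa> \<circ> finv h = place w0 (grig l \<circ> \<kappa> \<circ> finv (grig l))"
    by (intro conj_place h(2) bij_grigG h(1) grigG_generators) simp
  then show "place w0 (grig l \<circ> \<kappa> \<circ> grig l) \<in> Q" using Q_conj[OF grigK_conj_l.IH h(1)] by (simp only: inv_grig)
qed

lemma place_H:
  assumes \<kappa>: "\<kappa> \<in> grigK" and q: "length q = N + 14" shows "place q \<kappa> \<in> H"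
proof -
  have len: "length (u @ w0) = length q" using q by simp
  obtain g where g: "g \<in> grigG" "\<And>\<zeta>. g ((u @ w0) @- \<zeta>) = q @- \<zeta>" using grigG_transitive[OF len] by blast
  obtain W where W: "W \<in> lists {0, 1, 2}" "g = fold grig_gen W" using grigG_fold_grig_gen[OF g(1)] by blast
  define h where "h = fold X W"
  have hH: "h \<in> H" unfolding h_def by (rule triple_group_fold[OF W(1)])
  obtain q' g' where q': "length q' = length (u @ w0)" "g' \<in> grigG" "\<And>\<zeta>. h ((u @ w0) @- \<zeta>) = q' @- g' \<zeta>"
    using grigG_section[OF H_grigG[OF hH]] by blast
  have "q' = stake (N + 14) (h ((u @ w0) @- undefined))" using q' by (simp add: stake_shift)
  also have "\<dots> = stake (N + 14) (g ((u @ w0) @- undefined))"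
    unfolding h_def W(2) by (rule stake_le[OF fold_X_stake]) (use m in simp)
  also have "\<dots> = q" by (simp only: g(2)) (simp add: stake_shift q)
  finally have "q' = q" .
  \<comment> \<open>\<open>h\<close> agrees with \<open>g\<close> only on the first
    \<open>N + m\<close> digits, so its section \<open>g'\<close> is not controlled. Normality of
    \<open>grigK\<close> absorbs it.\<close>
  define \<kappa>' where "\<kappa>' = finv g' \<circ> \<kappa> \<circ> g'"
  have "place (u @ w0) \<kappa>' \<in> H" using place_Q[OF grigK_conj[OF q'(2) \<kappa>]] by (simp only: Q_def \<kappa>'_def place_append mem_Collect_eq)
  then have "h \<circ> place (u @ w0) \<kappa>' \<circ> finv h \<in> H" by (intro H_comp H_inv hH)
  moreover have "h \<circ> place (u @ w0) \<kappa>' \<circ> finv h = place q (g' \<circ> \<kappa>' \<circ> finv g')"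
    by (intro conj_place bij_H hH bij_grigG q'(2)) (use q' len \<open>q' = q\<close> in simp_all)
  moreover have "g' \<circ> \<kappa>' \<circ> finv g' = \<kappa>"
    using bij_grigG[OF q'(2)] by (simp add: \<kappa>'_def fun_eq_iff bij_is_surj surj_f_inv_f)
  ultimately show ?thesis by simp
qed

lemma perturbations_H: "f \<in> perturbations {p. length p = N} (replicate m 0) \<Longrightarrow> f \<in> H"
proof (induction rule: perturbations.induct)
  case perturbations_id
  show "id \<in> H" by (rule triple_group_id)
next
  case (perturbations_step f p \<kappa>)
  \<comment> \<open>The support of a perturbation lies below a vertex of level
    \<open>N + 14\<close>, where all of \<open>grigK\<close> is available in
    \<open>H\<close>.\<close>
  have "replicate m (0::bit) = replicate 14 0 @ replicate (m - 14) 0" using m(1) by (simp flip: replicate_add)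
  then have "place (p @ replicate m 0) \<kappa> = place (p @ replicate 14 0) (place (replicate (m - 14) 0) \<kappa>)"
    by (simp only: place_append)
  moreover have "place (p @ replicate 14 0) (place (replicate (m - 14) 0) \<kappa>) \<in> H"
    using perturbations_step by (intro place_H place_grigK) simp_all
  ultimately show "place (p @ replicate m 0) \<kappa> \<circ> f \<in> H" using perturbations_step by (intro H_comp) simp_all
qed

theorem generates: "H = grigG"
proof
  show "H \<subseteq> grigG" using H_grigG by blast
  have grig_gen: "grig_gen i \<in> H" if "i \<in> {0, 1, 2}" for i
  proof -
    have "X i \<circ> finv (k i) \<in> H" by (intro H_comp triple_group_generator that H_inv perturbations_H k)
    moreover have "X i \<circ> finv (k i) = grig_gen i"
      using bij_grigG[OF k_grigG, of i] by (simp add: X_def fun_eq_iff bij_is_surj surj_f_inv_f)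
    ultimately show ?thesis by simp
  qed
  show "grigG \<subseteq> H"
  proof
    fix g assume "g \<in> grigG"
    then obtain W where "W \<in> lists {0, 1, 2}" "g = fold grig_gen W" using grigG_fold_grig_gen by blast
    moreover from this(1) have "fold grig_gen W \<in> H"
    proof (induction W)
      case Nil
      show "fold grig_gen [] \<in> H" using triple_group_id by simp
    next
      case (Cons i W)
      then show "fold grig_gen (i # W) \<in> H" by (auto intro!: H_comp grig_gen)
    qed
    ultimately show "g \<in> H" by simp
  qed
qed

end

section \<open>Existence of generating triples injective on a ball\<close>

definition inner_vertices :: "nat \<Rightarrow> bit list set" where
  "inner_vertices N = {p. length p = N \<and> p \<noteq> line_start N \<and> p \<noteq> line_end N}"

lemma vertex_decomp:
  "p = line_start (length p) \<or> p = line_end (length p) \<or> (\<exists>j x r. p = replicate j 1 @ 0 # x # r)"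
proof (induction p)
  case (Cons y p)
  show ?case
  proof (cases "y = 0")
    case True
    show ?thesis
    proof (cases p)
      case Nil
      then show ?thesis using True by (simp add: line_end_def)
    next
      case (Cons x r)
      then have "y # p = replicate 0 1 @ 0 # x # r" using True by simp
      then show ?thesis by blast
    qed
  next
    case False
    then have y: "y = 1" by simp
    from Cons.IH show ?thesis
    proof (elim disjE exE)
      assume "p = line_end (length p)"
      then have "p \<noteq> []" by (auto simp: line_end_def)
      then have "replicate (length p) (1::bit) = 1 # replicate (length p - 1) 1" by (cases p) auto
      with \<open>p = line_end (length p)\<close> y show ?thesis by (simp add: line_end_def)
    next
      fix j x r assume "p = replicate j 1 @ 0 # x # r"
      then have "y # p = replicate (Suc j) 1 @ 0 # x # r" using y by simp
      then show ?thesis by blast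
    qed (simp add: line_start_def y)
  qed
qed (simp add: line_start_def)

text \<open>An inner vertex contains a zero and the digit after it. A letter changes at most this
  digit and has trivial section below.\<close>

lemma grig_gen_inner:
  assumes "p \<in> inner_vertices N"
  shows "\<exists>q. length q = N \<and> (\<forall>\<zeta>. grig_gen i (p @- \<zeta>) = q @- \<zeta>)"
proof -
  obtain j x r where p: "p = replicate j 1 @ 0 # x # r"
    using assms vertex_decomp[of p] by (auto simp: inner_vertices_def)
  have len: "length p = N" using assms by (simp add: inner_vertices_def)
  have "p \<noteq> []" using p by simp
  then obtain y p' where "p = y # p'" by (cases p) auto
  then have "length ((y + 1) # p') = N \<and> (\<forall>\<zeta>. grig_a (p @- \<zeta>) = ((y + 1) # p') @- \<zeta>)"
    using len by (simp add: grig_Cons)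
  then have "\<exists>q. length q = N \<and> (\<forall>\<zeta>. grig_a (p @- \<zeta>) = q @- \<zeta>)" by blast
  moreover have "\<exists>q. length q = N \<and> (\<forall>\<zeta>. grig l (p @- \<zeta>) = q @- \<zeta>)" for l
  proof -
    let ?l = "(grig_one ^^ j) l"
    define y where "y = (if ?l = Letter_d then x else x + 1)"
    have "grig l (p @- \<zeta>) = (replicate j 1 @ 0 # y # r) @- \<zeta>" for \<zeta>
      unfolding p y_def by (cases ?l) (simp_all add: grig_replicate grig_Cons del: grig_letters)
    moreover have "length (replicate j 1 @ 0 # y # r) = N" using len p by simp
    ultimately show ?thesis by blast
  qed
  from this[of Letter_b] this[of Letter_c]
  have "\<exists>q. length q = N \<and> (\<forall>\<zeta>. grig_b (p @- \<zeta>) = q @- \<zeta>)" "\<exists>q. length q = N \<and> (\<forall>\<zeta>. grig_c (p @- \<zeta>) = q @- \<zeta>)"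
    by simp_all
  ultimately show ?thesis unfolding grig_gen_def by (cases "i = 0"; cases "i = 1") simp_all
qed

lemma fold_grig_gen_rev: "fold grig_gen (rev W) (fold grig_gen W \<xi>) = \<xi>"
  by (induction W arbitrary: \<xi>) simp_all

text \<open>Short words started at such a \<open>q\<close> meet only inner vertices, where sections
  are trivial, so the tail \<open>\<zeta>\<close> is never altered.\<close>

lemma exists_base_vertex:
  "\<exists>N\<ge>1. \<exists>q. \<forall>W\<in>lists {0, 1, 2}. length W \<le> n \<longrightarrow>
     (\<exists>p\<in>inner_vertices N. fold grig_gen W (q @- \<zeta>) = p @- \<zeta>)"
proof -
  define S where "S = {W :: nat list. set W \<subseteq> {0, 1, 2} \<and> length W \<le> n}"
  have finS: "finite S" unfolding S_def by (rule finite_lists_length_le) simp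
  \<comment> \<open>This makes \<open>2 * card S\<close>, a bound for the number of bad vertices,
    smaller than \<open>2 ^ N\<close>.\<close>
  define N where "N = Suc (card S)"
  define Bad where "Bad = (\<lambda>(e, W). stake N (fold grig_gen W (e @- \<zeta>))) ` ({line_start N, line_end N} \<times> S)"
  have BadI: "stake N (fold grig_gen W (e @- \<zeta>)) \<in> Bad" if "e \<in> {line_start N, line_end N}" "W \<in> S" for e W
    unfolding Bad_def by (rule image_eqI[of _ _ "(e, W)"]) (use that in auto)
  have lv: "length (line_end N) = N" by (rule length_line_end) (simp add: N_def)
  have card2: "card (UNIV :: bit set) = 2"
  proof -
    have bits: "(UNIV :: bit set) = {0, 1}" using bit_not_zero_iff by auto
    show ?thesis by (subst bits) simp
  qed
  \<comment> \<open>A vertex that no short word takes to an end of the line exists because \<open>2^N\<close> exceeds the number of bad ones.\<close>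
  have "card Bad \<le> card ({line_start N, line_end N} \<times> S)" unfolding Bad_def by (rule card_image_le) (simp add: finS)
  also have "\<dots> = card {line_start N, line_end N} * card S" by (rule card_cartesian_product)
  also have "\<dots> \<le> 2 * card S" by (intro mult_right_mono) (simp_all add: card_insert_if)
  also have "\<dots> < 2 ^ N" using less_exp[of "card S"] by (simp add: N_def)
  also have "\<dots> = card {p :: bit list. set p \<subseteq> UNIV \<and> length p = N}"
    using card_lists_length_eq[of "UNIV :: bit set" N] card2 by (metis card_eq_0_iff zero_neq_numeral)
  finally have "card Bad < card {p :: bit list. length p = N}" by simp
  moreover have "finite Bad" unfolding Bad_def using finS by simp
  ultimately obtain q where q: "length q = N" "q \<notin> Bad"
    by (metis (mono_tags, lifting) card_mono leD mem_Collect_eq subsetI)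
  have "\<exists>p\<in>inner_vertices N. fold grig_gen W (q @- \<zeta>) = p @- \<zeta>" if "W \<in> S" for W
    using that
  proof (induction W rule: rev_induct)
    case Nil
    have "stake N (line_start N @- \<zeta>) \<in> Bad" "stake N (line_end N @- \<zeta>) \<in> Bad"
      using BadI[OF _ Nil, of "line_start N"] BadI[OF _ Nil, of "line_end N"] by simp_all
    then have "line_start N \<in> Bad" "line_end N \<in> Bad" using lv by (simp_all add: stake_shift)
    then have "q \<in> inner_vertices N" using q by (auto simp: inner_vertices_def)
    then show ?case by auto
  next
    case (snoc i W)
    then have "W \<in> S" by (simp add: S_def)
    with snoc obtain p where p: "p \<in> inner_vertices N" "fold grig_gen W (q @- \<zeta>) = p @- \<zeta>" by blast
    obtain p' where p': "length p' = N" "grig_gen i (p @- \<zeta>) = p' @- \<zeta>" using grig_gen_inner[OF p(1)] by blast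
    have W: "fold grig_gen (W @ [i]) (q @- \<zeta>) = p' @- \<zeta>" by (simp add: p p')
    have "fold grig_gen (rev (W @ [i])) (p' @- \<zeta>) = q @- \<zeta>"
      unfolding W[symmetric] by (rule fold_grig_gen_rev)
    then have "q = stake N (fold grig_gen (rev (W @ [i])) (p' @- \<zeta>))" using q(1) by (simp only: stake_shift) simp
    moreover have "rev (W @ [i]) \<in> S" using snoc.prems by (simp add: S_def)
    ultimately have "p' \<notin> {line_start N, line_end N}" using q(2) BadI[of p' "rev (W @ [i])"] by metis
    then show ?case using p'(1) W by (auto simp: inner_vertices_def)
  qed
  then have "\<forall>W\<in>lists {0, 1, 2}. length W \<le> n \<longrightarrow> (\<exists>p\<in>inner_vertices N. fold grig_gen W (q @- \<zeta>) = p @- \<zeta>)"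
    by (auto simp: S_def)
  moreover have "N \<ge> 1" by (simp add: N_def)
  ultimately show ?thesis by blast
qed

text \<open>Edges of the Schreier graph along which the generator has trivial section.\<close>

definition adjacent :: "bit list \<Rightarrow> bit list \<Rightarrow> bool" where
  "adjacent p q \<longleftrightarrow> (\<exists>i\<in>{0, 1, 2}. \<forall>\<zeta>. grig_gen i (p @- \<zeta>) = q @- \<zeta>)"

lemma adjacent_sym: "adjacent p q \<Longrightarrow> adjacent q p"
  unfolding adjacent_def by (metis grig_gen_grig_gen)

lemma adjacent_append: "adjacent p q \<Longrightarrow> adjacent (p @ r) (q @ r)"
  unfolding adjacent_def by (metis shift_append)

lemma replicate_snoc: "replicate n x @ [x] = replicate (Suc n) x"
  by (simp add: replicate_append_same)

lemma exists_schreier_path: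
  "N \<ge> 1 \<Longrightarrow> \<exists>ps. ps \<noteq> [] \<and> hd ps = line_start N \<and> last ps = line_end N \<and> distinct ps \<and>
     successively adjacent ps \<and> (\<forall>p\<in>set ps. length p = N)"
proof (induction N rule: nat_induct_at_least)
  case base
  have "adjacent [1] [0]" unfolding adjacent_def by (intro bexI[of _ 0]) (simp_all add: grig_rec)
  then show ?case by (intro exI[of _ "[[1], [0]]"]) (simp add: line_start_def line_end_def)
next
  case (Suc N)
  then obtain ps where ps: "ps \<noteq> []" "hd ps = line_start N" "last ps = line_end N" "distinct ps"
    "successively adjacent ps" "\<And>p. p \<in> set ps \<Longrightarrow> length p = N" by blast
  \<comment> \<open>The next level consists of two copies of the line, joined at
    \<open>line_end N\<close>, below which some generator acts as \<open>a\<close> and exchanges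
    \<open>1\<close> and \<open>0\<close>.\<close>
  let ?qs = "map (\<lambda>p. p @ [1]) ps @ map (\<lambda>p. p @ [0]) (rev ps)"
  have "line_start N @ [1] = line_start (Suc N)" "line_start N @ [0] = line_end (Suc N)" by (simp_all add: line_start_def line_end_def replicate_snoc)
  then have "?qs \<noteq> []" "hd ?qs = line_start (Suc N)" "last ?qs = line_end (Suc N)"
    using ps(1,2) by (simp_all add: hd_map last_map last_rev)
  moreover have "distinct ?qs" using ps(4) by (auto simp: distinct_map inj_on_def)
  moreover have "\<forall>p\<in>set ?qs. length p = Suc N" using ps(6) by auto
  moreover have "successively adjacent ?qs"
  proof -
    have up: "successively adjacent (map (\<lambda>p. p @ [x]) ps)" for x
      unfolding successively_map using ps(5) by (rule successively_mono) (auto intro: adjacent_append)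
    have "successively adjacent (map (\<lambda>p. p @ [0]) (rev ps))"
      unfolding rev_map[symmetric] successively_rev
      using up[of 0] by (rule successively_mono) (auto intro: adjacent_sym)
    moreover have "adjacent (line_end N @ [1]) (line_end N @ [0])"
    proof -
      obtain i where "i \<in> {1, 2}" "\<And>\<zeta>. grig_gen i (line_end N @- \<zeta>) = line_end N @- grig_a \<zeta>" using grig_gen_line_end by blast
      then show ?thesis unfolding adjacent_def by (intro bexI[of _ i]) (auto simp: grig_rec)
    qed
    ultimately show ?thesis using up[of 1] ps(1,3)
      by (simp add: successively_append_iff last_map hd_map hd_rev)
  qed
  ultimately show ?case by blast
qed

text \<open>The edges have trivial sections, so only the perturbations contribute, and these
  multiply to one \<open>\<kappa>\<close>. The quantifier over \<open>X'\<close> records that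
  changes at the avoided vertex \<open>u\<close> have no influence.\<close>

lemma follow_path:
  assumes "ps \<noteq> []" "successively adjacent ps" "u \<notin> set ps" "\<And>p. p \<in> set ps \<Longrightarrow> length p = N"
    and X: "\<And>i p. length p = N \<Longrightarrow> p \<noteq> u \<Longrightarrow> \<exists>\<kappa>\<in>grigK. \<forall>\<zeta>. X i (p @- \<zeta>) = grig_gen i (p @- place z \<kappa> \<zeta>)"
  shows "\<exists>W\<in>lists {0, 1, 2}. \<exists>\<kappa>\<in>grigK. \<forall>X'.
    (\<forall>i p \<zeta>. length p = N \<longrightarrow> p \<noteq> u \<longrightarrow> X' i (p @- \<zeta>) = X i (p @- \<zeta>)) \<longrightarrow>
    (\<forall>\<zeta>. fold X' W (hd ps @- \<zeta>) = last ps @- place z \<kappa> \<zeta>)"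
  using assms(1-4)
proof (induction ps)
  case (Cons p ps)
  show ?case
  proof (cases "ps = []")
    case True
    then have "\<forall>\<zeta>. fold X' [] (hd (p # ps) @- \<zeta>) = last (p # ps) @- place z id \<zeta>" for X' by simp
    then show ?thesis using grigK_id by (intro bexI[of _ "[]"] bexI[of _ id]) blast+
  next
    case False
    then have "successively adjacent ps" "adjacent p (hd ps)" using Cons.prems(2) by (auto simp: successively_Cons)
    have "u \<notin> set ps" "\<And>p. p \<in> set ps \<Longrightarrow> length p = N" using Cons.prems(3,4) by auto
    from Cons.IH[OF False \<open>successively adjacent ps\<close> this] obtain W \<kappa> where W: "W \<in> lists {0, 1, 2}" "\<kappa> \<in> grigK"
      "\<And>X' \<zeta>. (\<forall>i p \<zeta>. length p = N \<longrightarrow> p \<noteq> u \<longrightarrow> X' i (p @- \<zeta>) = X i (p @- \<zeta>)) \<Longrightarrow>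
         fold X' W (hd ps @- \<zeta>) = last ps @- place z \<kappa> \<zeta>" by blast
    obtain i where i: "i \<in> {0, 1, 2}" "\<And>\<zeta>. grig_gen i (p @- \<zeta>) = hd ps @- \<zeta>"
      using \<open>adjacent p (hd ps)\<close> unfolding adjacent_def by blast
    have p: "length p = N" "p \<noteq> u" using Cons.prems(3,4) by auto
    obtain \<kappa>' where \<kappa>': "\<kappa>' \<in> grigK" "\<And>\<zeta>. X i (p @- \<zeta>) = grig_gen i (p @- place z \<kappa>' \<zeta>)"
      using X[OF p] by blast
    have "fold X' (i # W) (hd (p # ps) @- \<zeta>) = last (p # ps) @- place z (\<kappa> \<circ> \<kappa>') \<zeta>"
      if "\<forall>i p \<zeta>. length p = N \<longrightarrow> p \<noteq> u \<longrightarrow> X' i (p @- \<zeta>) = X i (p @- \<zeta>)" for X' \<zeta>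
    proof -
      have "X' i (p @- \<zeta>) = hd ps @- place z \<kappa>' \<zeta>" using that p by (simp add: \<kappa>' i(2))
      then show ?thesis using False W(3)[OF that] by (simp add: place_comp)
    qed
    moreover have "i # W \<in> lists {0, 1, 2}" "\<kappa> \<circ> \<kappa>' \<in> grigK" using i W \<kappa>' by (auto intro: grigK_comp)
    ultimately show ?thesis by blast
  qed
qed simp

lemma letter_map_grig_gen: "letter_map grig_gen l = grig_gen (fst l)"
  by (simp add: letter_map_def inv_grig_gen)

lemma act_grig_gen: "act grig_gen w = fold grig_gen (map fst w)"
  by (induction w) (simp_all add: act_Cons letter_map_grig_gen)

lemma act_cong:
  assumes "\<And>i. grigG_cong n (X i) (Y i)" shows "grigG_cong n (act X w) (act Y w)"
proof (induction w)
  case Nil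
  show "grigG_cong n (act X []) (act Y [])" by (simp add: grigG_cong_def grigG_id)
next
  case (Cons l w)
  have "grigG_cong n (letter_map X l) (letter_map Y l)"
    unfolding letter_map_def using assms grigG_cong_inv by simp
  then show "grigG_cong n (act X (l # w)) (act Y (l # w))" unfolding act_Cons by (intro grigG_cong_comp Cons.IH)
qed

lemma exists_generating_triple:
  "\<exists>X. (\<forall>i. X i \<in> grigG) \<and> triple_group X = grigG \<and> inj_on (act X) (ball_words {0, 1, 2} n)"
proof -
  define \<zeta>0 :: bits where "\<zeta>0 = sconst 0"
  obtain N q0 where N: "N \<ge> 1" and q0: "\<And>W. W \<in> lists {0, 1, 2} \<Longrightarrow> length W \<le> n \<Longrightarrow>
     \<exists>p\<in>inner_vertices N. fold grig_gen W (q0 @- \<zeta>0) = p @- \<zeta>0"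
    using exists_base_vertex[of n \<zeta>0] by blast
  obtain WA where WA: "WA \<in> lists {0, 1, 2}" "fold grig_gen WA = place (line_start N) comm_left"
    using grigG_fold_grig_gen[OF grigK_grigG[OF place_grigK[OF comm_left_comm_right_grigK(1)]]] by metis
  obtain WB where WB: "WB \<in> lists {0, 1, 2}" "fold grig_gen WB = place (line_start N) comm_right"
    using grigG_fold_grig_gen[OF grigK_grigG[OF place_grigK[OF comm_left_comm_right_grigK(2)]]] by metis
  define M where "M = N + 2 * max (length WA) (length WB)"
  have "N \<le> M" by (simp add: M_def)
  then obtain c where c: "c \<in> grigK" "\<And>\<zeta>. c (line_start N @- \<zeta>) = line_start N @- \<zeta>"
    "\<And>\<xi>. stake N \<xi> \<noteq> line_start N \<Longrightarrow> c \<xi> !! Suc M = \<xi> !! Suc M + 1"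
    using exists_shifter by blast
  obtain WC where WC: "WC \<in> lists {0, 1, 2}" "fold grig_gen WC = c"
    using grigG_fold_grig_gen[OF grigK_grigG[OF c(1)]] by metis
  \<comment> \<open>\<open>14\<close> is the length of \<open>w0\<close>, and \<open>M\<close>
    brings position \<open>M + 1\<close> within the first \<open>N + m\<close> digits.\<close>
  define m where "m = 14 + M"
  define z where "z = replicate m (0::bit)"
  define U where "U = inner_vertices N"
  \<comment> \<open>These are the points below the vertices \<open>pz\<close> with \<open>p\<close>
    inner, where perturbations can separate. The base point has the zero tail, so its images under
    short words remain there.\<close>
  define V where "V = {\<xi>. \<exists>p\<in>U. stake (N + m) \<xi> = p @ z}"
  define \<xi>0 where "\<xi>0 = q0 @- \<zeta>0"
  have len_U: "length p = N" if "p \<in> U" for p using that by (simp add: U_def inner_vertices_def)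
  have lz: "length z = m" by (simp add: z_def)
  have perturbations_grigG: "f \<in> perturbations U z \<Longrightarrow> f \<in> grigG" for f using perturbations_grigK grigK_grigG by blast
  have zero: "stake (N + m) (p @- \<zeta>0) = p @ z" if "length p = N" for p
  proof -
    have "stake m \<zeta>0 = z" unfolding \<zeta>0_def z_def by (induction m) (simp_all del: stake_siterate)
    then show ?thesis using that by (simp add: stake_shift)
  qed
  have in_V: "act X w \<xi>0 \<in> V"
    if X: "\<And>i. grigG_cong (N + m) (X i) (grig_gen i)" and w: "w \<in> lists ({0, 1, 2} \<times> UNIV)" "length w \<le> n" for X w
  proof -
    have "map fst w \<in> lists {0, 1, 2}" using w(1) by (induction w) auto
    then obtain p where p: "p \<in> U" "fold grig_gen (map fst w) \<xi>0 = p @- \<zeta>0"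
      using q0[of "map fst w"] w(2) unfolding U_def \<xi>0_def by auto
    have "grigG_cong (N + m) (act X w) (act grig_gen w)" using X by (rule act_cong)
    then have "stake (N + m) (act X w \<xi>0) = stake (N + m) (act grig_gen w \<xi>0)" unfolding grigG_cong_def by blast
    also have "\<dots> = p @ z" using zero[OF len_U[OF p(1)]] by (simp add: act_grig_gen p(2))
    finally show ?thesis using p(1) by (auto simp: V_def)
  qed
  have perturbations_cong: "grigG_cong (N + m) (grig_gen i \<circ> f) (grig_gen i)" if "f \<in> perturbations U' z" "\<And>q. q \<in> U' \<Longrightarrow> length q = N" for f i U'
  proof -
    have "stake (N + length z) (f \<xi>) = stake (N + length z) \<xi>" for \<xi> by (rule perturbations_stake[OF that])
    then have "grigG_cong (N + m) f id" using that(1) perturbations_grigK grigK_grigG grigG_id by (auto simp: grigG_cong_def lz)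
    then have "grigG_cong (N + m) (grig_gen i \<circ> f) (grig_gen i \<circ> id)"
      by (intro grigG_cong_comp) (simp_all add: grigG_cong_def grig_gen_grigG)
    then show ?thesis by simp
  qed
  interpret separating_perturbations "{0, 1, 2}" grig_gen "perturbations U z" n \<xi>0 V
  proof
    show "bij (grig_gen i)" for i by (rule bij_grigG[OF grig_gen_grigG])
    show "bij k" if "k \<in> perturbations U z" for k using bij_grigG perturbations_grigG that by blast
    show "id \<in> perturbations U z" by (rule perturbations_id)
    show "f \<circ> k \<in> perturbations U z" if "f \<in> perturbations U z" "k \<in> perturbations U z" for f k by (rule perturbations_comp[OF that])
    show "act (\<lambda>i. grig_gen i \<circ> k i) w \<xi>0 \<in> V"
      if "\<And>i. k i \<in> perturbations U z" "w \<in> lists ({0, 1, 2} \<times> UNIV)" "length w \<le> n" for k w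
      by (rule in_V[OF _ that(2,3)]) (intro perturbations_cong[OF that(1)] len_U)
    show "\<exists>k\<in>perturbations U z. (\<forall>y\<in>F. k y = y) \<and> k x \<noteq> x" if "x \<in> V" "finite F" "x \<notin> F" for x F
      using that perturbations_separates[of _ U z x F] len_U lz by (auto simp: V_def)
  qed
  obtain k where k: "\<And>i. k i \<in> perturbations U z"
    and inj: "inj_on (\<lambda>w. act (\<lambda>i. grig_gen i \<circ> k i) w \<xi>0) (ball_words {0, 1, 2} n)"
    using exists_injective_on_ball by auto
  define X where "X = (\<lambda>i. grig_gen i \<circ> k i)"
  have lv: "length (line_end N) = N" using length_line_end N .
  have uU: "line_start N \<notin> U" "line_end N \<notin> U" by (simp_all add: U_def inner_vertices_def)
  have k_fix: "k i (p @- \<zeta>) = p @- \<zeta>" if "p \<notin> U" "length p = N" for i p \<zeta>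
    using perturbations_section[OF k[of i], of p] that len_U by auto
  obtain ps where ps: "ps \<noteq> []" "hd ps = line_start N" "last ps = line_end N" "distinct ps"
    "successively adjacent ps" "\<And>p. p \<in> set ps \<Longrightarrow> length p = N"
    using exists_schreier_path[OF N] by blast
  have "line_end N \<noteq> line_start N"
  proof
    assume "line_end N = line_start N"
    then have "(0::bit) \<in> set (replicate N 1)" unfolding line_end_def line_start_def by (metis in_set_conv_decomp)
    then show False by simp
  qed
  then obtain ps' where ps': "ps = line_start N # ps'" "ps' \<noteq> []" using ps(1-3) by (cases ps) (auto split: if_splits)
  have "adjacent (line_start N) (hd ps')" "successively adjacent ps'" using ps(5) ps' by (auto simp: successively_Cons)
  then obtain i where i: "i \<in> {0, 1, 2}" "\<And>\<zeta>. grig_gen i (line_start N @- \<zeta>) = hd ps' @- \<zeta>"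
    unfolding adjacent_def by blast
  have "hd ps' \<in> set ps'" by (rule hd_in_set[OF ps'(2)])
  then have "hd ps' \<in> set ps" "hd ps' \<noteq> line_start N" using ps(4) unfolding ps'(1) by auto
  then have hd: "hd ps' \<noteq> line_start N" "length (hd ps') = N" by (blast intro: ps(6))+
  \<comment> \<open>\<open>b\<close> and \<open>c\<close> fix the vertex
    \<open>line_start N\<close>, so the step leaving it is made by \<open>a\<close>.\<close>
  have "i = 0"
  proof (rule ccontr)
    assume "i \<noteq> 0"
    then have "grig_gen i = grig Letter_b \<or> grig_gen i = grig Letter_c" using i(1) by auto
    then obtain l where "grig_gen i = grig l" by blast
    then have "stake N (hd ps' @- \<zeta>0) = line_start N" unfolding i(2)[symmetric] by (simp add: grig_line_start stake_shift)
    then show False using hd by (simp add: stake_shift)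
  qed
  with i have a: "grig_a (line_start N @- \<zeta>) = hd ps' @- \<zeta>" for \<zeta> by simp
  have sec: "\<exists>\<kappa>\<in>grigK. \<forall>\<zeta>. X i (p @- \<zeta>) = grig_gen i (p @- place z \<kappa> \<zeta>)" if "length p = N" for i p
  proof -
    have "length q = length p" if "q \<in> U" for q using len_U that \<open>length p = N\<close> by simp
    from perturbations_section[OF k[of i] this] obtain \<kappa> where "\<kappa> \<in> grigK" "\<And>\<zeta>. k i (p @- \<zeta>) = p @- place z \<kappa> \<zeta>"
      by blast
    then show ?thesis unfolding X_def by (intro bexI[of _ \<kappa>]) simp_all
  qed
  have "line_start N \<notin> set ps'" using ps(4) unfolding ps'(1) by simp
  moreover have "length p = N" if "p \<in> set ps'" for p using that ps'(1) by (intro ps(6)) simp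
  moreover have last: "last ps' = line_end N" using ps(3) ps'(2) unfolding ps'(1) by simp
  ultimately have "\<exists>W\<in>lists {0, 1, 2}. \<exists>\<kappa>\<in>grigK. \<forall>X'.
    (\<forall>i p \<zeta>. length p = N \<longrightarrow> p \<noteq> line_start N \<longrightarrow> X' i (p @- \<zeta>) = X i (p @- \<zeta>)) \<longrightarrow>
    (\<forall>\<zeta>. fold X' W (hd ps' @- \<zeta>) = last ps' @- place z \<kappa> \<zeta>)"
    by (intro follow_path[OF ps'(2) \<open>successively adjacent ps'\<close>] sec)
  then obtain W \<kappa> where W: "W \<in> lists {0, 1, 2}" "\<kappa> \<in> grigK"
    "\<And>X' \<zeta>. (\<And>i p \<zeta>. length p = N \<Longrightarrow> p \<noteq> line_start N \<Longrightarrow> X' i (p @- \<zeta>) = X i (p @- \<zeta>)) \<Longrightarrow>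
         fold X' W (hd ps' @- \<zeta>) = line_end N @- place z \<kappa> \<zeta>"
    unfolding last by metis
  \<comment> \<open>The first step of the walk is by \<open>a\<close> and the walk never returns to its start, so correcting \<open>a\<close> there does not affect \<open>\<kappa>\<close>.\<close>
  define r where "r = place (line_start N @ z) (finv \<kappa>)"
  have rK: "r \<in> grigK" unfolding r_def by (intro place_grigK inv_grigK W(2))
  have bij_r: "bij r" and bij_\<kappa>: "bij \<kappa>" using rK W(2) grigK_grigG bij_grigG by blast+
  have r_other: "r \<xi> = \<xi>" if "stake N \<xi> \<noteq> line_start N" for \<xi>
    using that unfolding r_def place_append by (intro place_outside) simp
  define k' where "k' = k(0 := k 0 \<circ> r)"
  define X' where "X' = (\<lambda>i. grig_gen i \<circ> k' i)"
  have X'0: "X' 0 = X 0 \<circ> r" "i \<noteq> 0 \<Longrightarrow> X' i = X i" for i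
    by (simp_all add: X'_def X_def k'_def comp_assoc)
  have k'_perturbations: "k' i \<in> perturbations {p. length p = N} z" for i
  proof -
    have U: "U \<subseteq> {p. length p = N}" using len_U by blast
    have "r \<in> perturbations {p. length p = N} z" unfolding r_def by (intro perturbations_place inv_grigK W(2)) simp
    with perturbations_mono[OF k U] have "k 0 \<circ> r \<in> perturbations {p. length p = N} z" by (rule perturbations_comp)
    then show ?thesis using perturbations_mono[OF k[of i] U] unfolding k'_def by (cases "i = 0") simp_all
  qed
  have "perturbed_triple N m k' WA WB WC"
  proof (unfold_locales, fold M_def X'_def)
    show "1 \<le> N" by (rule N)
    show "k' i \<in> perturbations {p. length p = N} (replicate m 0)" for i using k'_perturbations unfolding z_def .
    show "k' i (line_start N @- \<zeta>) = line_start N @- \<zeta>" "k' i (line_end N @- \<zeta>) = line_end N @- \<zeta>" if "i \<in> {1, 2}" for i \<zeta>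
      using that k_fix[OF uU(1) length_line_start] k_fix[OF uU(2) lv] by (auto simp: k'_def)
    have "fold X' (0 # W) (line_start N @- \<zeta>) = line_end N @- \<zeta>" for \<zeta>
    proof -
      have "X' 0 (line_start N @- \<zeta>) = hd ps' @- place z (finv \<kappa>) \<zeta>"
        by (simp add: X'0 r_def place_append X_def k_fix[OF uU(1)] a)
      moreover have "fold X' W (hd ps' @- \<zeta>') = line_end N @- place z \<kappa> \<zeta>'" for \<zeta>'
      proof (rule W(3))
        fix i p \<eta> assume "length p = N" "p \<noteq> line_start N"
        then show "X' i (p @- \<eta>) = X i (p @- \<eta>)"
          using r_other[of "p @- \<eta>"] by (cases "i = 0") (simp_all add: X'0 stake_shift)
      qed
      moreover have "place z \<kappa> (place z (finv \<kappa>) \<zeta>) = \<zeta>"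
      proof -
        have "place z \<kappa> \<circ> place z (finv \<kappa>) = id"
          using bij_\<kappa> by (simp flip: place_comp add: bij_is_surj surj_iff[THEN iffD1])
        then show ?thesis by (simp add: fun_eq_iff)
      qed
      ultimately show ?thesis by simp
    qed
    then show "\<exists>W\<in>lists {0, 1, 2}. \<forall>\<zeta>. fold X' W (line_start N @- \<zeta>) = line_end N @- \<zeta>"
      using W(1) by (intro bexI[of _ "0 # W"]) auto
    show "WA \<in> lists {0, 1, 2}" "fold grig_gen WA = place (line_start N) comm_left" by (fact WA)+
    show "WB \<in> lists {0, 1, 2}" "fold grig_gen WB = place (line_start N) comm_right" by (fact WB)+
    show "WC \<in> lists {0, 1, 2}" by (fact WC)
    show "fold grig_gen WC (line_start N @- \<zeta>) = line_start N @- \<zeta>" for \<zeta> by (simp only: WC c)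
    show "fold grig_gen WC \<xi> !! Suc M = \<xi> !! Suc M + 1" if "stake N \<xi> \<noteq> line_start N" for \<xi>
      unfolding WC(2) by (rule c(3)[OF that])
    show "14 \<le> m" "Suc M < N + m" using N by (simp_all add: m_def)
  qed
  then interpret T: perturbed_triple N m k' WA WB WC M X'
    by (simp_all only: M_def X'_def)
  have bijX: "bij (X i)" for i unfolding X_def by (intro bij_comp bij_grigG[OF grig_gen_grigG] bij_grigG[OF perturbations_grigG] k)
  have V_other: "r \<xi> = \<xi>" if "\<xi> \<in> V" for \<xi>
  proof (rule r_other)
    obtain p where p: "p \<in> U" "stake (N + m) \<xi> = p @ z" using \<open>\<xi> \<in> V\<close> unfolding V_def by blast
    then have "take N (stake (N + m) \<xi>) = p" using len_U by simp
    then have "stake N \<xi> = p" by (simp add: take_stake)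
    then show "stake N \<xi> \<noteq> line_start N" using p(1) uU(1) by auto
  qed
  have same: "act X' w \<xi>0 = act X w \<xi>0" if "w \<in> lists ({0, 1, 2} \<times> UNIV)" "length w \<le> n" for w
    using that
  proof (induction w rule: rev_induct)
    case (snoc l w)
    have X_cong: "grigG_cong (N + m) (X i) (grig_gen i)" for i
      unfolding X_def by (rule perturbations_cong[OF k len_U])
    have w: "act X' w \<xi>0 = act X w \<xi>0" using snoc by simp
    have V: "act X w \<xi>0 \<in> V" "act X (w @ [l]) \<xi>0 \<in> V" using snoc.prems by (auto intro!: in_V X_cong simp del: act_simps)
    obtain i e where l: "l = (i, e)" by (cases l)
    \<comment> \<open>The correction \<open>r\<close> acts below \<open>line_start N\<close> only,
      away from \<open>V\<close>. Agreement at the old end point settles a positive letter and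
      agreement at the new one an inverse letter.\<close>
    have "X' i (act X w \<xi>0) = X i (act X w \<xi>0)" "X' i (act X (w @ [l]) \<xi>0) = X i (act X (w @ [l]) \<xi>0)"
      using V_other[OF V(1)] V_other[OF V(2)] by (cases "i = 0"; simp add: X'0 del: act_simps)+
    note X'_eq = this
    show ?case
    proof (cases e)
      case True
      then show ?thesis using X'_eq(1) by (simp add: l w)
    next
      case False
      have "X i (finv (X i) (act X w \<xi>0)) = act X w \<xi>0" using bijX[of i] by (simp add: bij_is_surj surj_f_inv_f)
      then have "X' i (finv (X i) (act X w \<xi>0)) = act X w \<xi>0" using X'_eq(2) False by (simp add: l)
      then have "finv (X' i) (act X w \<xi>0) = finv (X i) (act X w \<xi>0)"
        by (intro inv_f_eq bij_is_inj T.bij_X)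
      then show ?thesis using False by (simp add: l w)
    qed
  qed simp
  have "inj_on (act X') (ball_words {0, 1, 2} n)"
  proof (rule inj_onI)
    fix v w assume vw: "v \<in> ball_words {0, 1, 2} n" "w \<in> ball_words {0, 1, 2} n" "act X' v = act X' w"
    then have "act X v \<xi>0 = act X w \<xi>0" using same[of v] same[of w] by (simp add: ball_words_def)
    then show "v = w" by (rule inj_onD[OF inj[folded X_def] _ vw(1,2)])
  qed
  then show ?thesis using T.generates T.X_grigG by blast
qed

section \<open>Transfer to the groups of the theorem\<close>

lemma grigorchuk_group_simps [simp]:
  "f \<otimes>\<^bsub>grigorchuk_group\<^esub> g = g \<circ> f" "\<one>\<^bsub>grigorchuk_group\<^esub> = id"
  by (simp_all add: grigorchuk_group_def right_bij_group_def)

lemma carrier_grigorchuk_group_eq: "carrier grigorchuk_group = grigG"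
proof -
  interpret R: group right_bij_group by (rule group_right_bij_group)
  have mult: "f \<otimes>\<^bsub>right_bij_group\<^esub> g = g \<circ> f" "\<one>\<^bsub>right_bij_group\<^esub> = id" for f g :: "bits \<Rightarrow> bits"
    by (simp_all add: right_bij_group_def)
  let ?S = "{grig_a, grig_b, grig_c, grig_d}"
  show ?thesis unfolding carrier_grigorchuk_group
  proof (intro equalityI subsetI)
    fix g assume "g \<in> generate right_bij_group ?S"
    then show "g \<in> grigG"
    proof (induction rule: generate.induct)
      case one
      show "\<one>\<^bsub>right_bij_group\<^esub> \<in> grigG" using grigG_id by (simp only: mult)
    next
      case (incl h)
      then show ?case using grigG_generators by auto
    next
      case (inv h)
      then have "h \<circ> h = id" by (auto simp: fun_eq_iff)
      moreover have "bij h" using inv bij_grig by blast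
      ultimately have "inv\<^bsub>right_bij_group\<^esub> h = h"
        by (intro R.inv_equality) (simp_all add: right_bij_group_def)
      then show ?case using inv grigG_generators by auto
    next
      case (eng f g)
      then show "f \<otimes>\<^bsub>right_bij_group\<^esub> g \<in> grigG" by (simp add: mult grigG_comp)
    qed
  next
    have letter: "grig l \<in> ?S" for l by (cases l) simp_all
    fix g assume "g \<in> grigG"
    then show "g \<in> generate right_bij_group ?S"
    proof (induction rule: grigG.induct)
      case grigG_id
      show "id \<in> generate right_bij_group ?S" using generate.one[of right_bij_group ?S] by (simp only: mult)
    next
      case (grigG_a g)
      then show "grig_a \<circ> g \<in> generate right_bij_group ?S"
        using generate.eng[OF grigG_a.IH generate.incl[of grig_a ?S right_bij_group]] by (simp add: mult)
    next
      case (grigG_l g l)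
      then show "grig l \<circ> g \<in> generate right_bij_group ?S"
        using generate.eng[OF grigG_l.IH generate.incl[OF letter[of l]]] by (simp add: mult)
    qed
  qed
qed

lemma eval_word_grigorchuk_group:
  assumes "\<And>i. X i \<in> grigG" shows "eval_word grigorchuk_group X w = act X w"
proof (induction w)
  case (Cons l w)
  have "inv\<^bsub>grigorchuk_group\<^esub> (X i) = finv (X i)" for i
  proof (rule group.inv_equality[OF group_grigorchuk_group])
    show "finv (X i) \<otimes>\<^bsub>grigorchuk_group\<^esub> X i = \<one>\<^bsub>grigorchuk_group\<^esub>"
      using bij_grigG[OF assms, of i] by (simp add: bij_is_surj surj_iff[THEN iffD1])
  qed (simp_all add: carrier_grigorchuk_group_eq assms inv_grigG)
  then show ?case using Cons by (simp add: eval_word_def act_Cons letter_map_def split_beta)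
qed (simp add: eval_word_def)

theorem theorem3:
  shows "preforms grigorchuk_group (free_group {0, 1, 2 :: nat})"
proof -
  let ?I = "{0, 1, 2 :: nat}"
  let ?F = "free_group ?I"
  have "\<exists>X. \<forall>n. (\<forall>i. X n i \<in> grigG) \<and> triple_group (X n) = grigG \<and> inj_on (act (X n)) (ball_words ?I (Suc n))"
    by (intro choice allI exists_generating_triple)
  then obtain X where X: "\<And>n i. X n i \<in> grigG" "\<And>n. triple_group (X n) = grigG"
    "\<And>n. inj_on (act (X n)) (ball_words ?I (Suc n))" by blast
  have carrier: "carrier ?F = {w. reduced w \<and> w \<in> lists (?I \<times> UNIV)}"
    unfolding free_group_def lists_eq_set by auto
  have eval: "eval_word grigorchuk_group (X n) = act (X n)" for n
    using eval_word_grigorchuk_group[of "X n"] X(1) by blast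
  have hom: "act (X n) \<in> hom ?F grigorchuk_group" for n
    using free_group_universal(1)[OF group_grigorchuk_group, of "X n" ?I] X(1)
    by (simp add: eval carrier_grigorchuk_group_eq)
  have surj: "act (X n) ` carrier ?F = carrier grigorchuk_group" for n
  proof
    show "act (X n) ` carrier ?F \<subseteq> carrier grigorchuk_group" using hom by (auto simp: hom_def)
    \<comment> \<open>\<open>triple_group\<close> uses arbitrary words, the free group reduced ones;
      multiplying letter by letter in the free group replaces the former by the latter.\<close>
    have "act (X n) w \<in> act (X n) ` carrier ?F" if "w \<in> lists (?I \<times> UNIV)" for w
      using that
    proof (induction w)
      case Nil
      have "[] \<in> carrier ?F" unfolding carrier by simp
      then show ?case by blast
    next
      case (Cons l w)
      then obtain w' where w': "w' \<in> carrier ?F" "act (X n) w = act (X n) w'" by blast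
      have l: "[l] \<in> carrier ?F" using Cons.hyps(1) unfolding carrier by simp
      have "act (X n) (l # w) = act (X n) ([l] \<otimes>\<^bsub>?F\<^esub> w')"
        using hom_mult[OF hom l w'(1), of n] by (simp add: act_Cons w'(2))
      moreover have "[l] \<otimes>\<^bsub>?F\<^esub> w' \<in> carrier ?F"
        using l w'(1) monoid.m_closed[OF group.is_monoid[OF group_free_group]] by blast
      ultimately show ?case by blast
    qed
    then show "carrier grigorchuk_group \<subseteq> act (X n) ` carrier ?F"
      unfolding carrier_grigorchuk_group_eq X(2)[of n, symmetric] triple_group_def by blast
  qed
  have "ball_vertices (cayley_graph ?F ((\<lambda>x. [(x, True)]) ` ?I)) (Suc n) \<subseteq> ball_words ?I (Suc n)" for n
  proof -
    have "ball_words ?I (Suc n) = {w \<in> carrier ?F. length w \<le> Suc n}"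
      unfolding ball_words_def carrier by blast
    then show ?thesis using free_group_ball_vertices by (simp only:)
  qed
  then have inj: "inj_on (act (X n)) (ball_vertices (cayley_graph ?F ((\<lambda>x. [(x, True)]) ` ?I)) (Suc n))" for n
    using X(3) by (rule inj_on_subset[rotated])
  show ?thesis
    by (rule preforms_if_homs[OF group_grigorchuk_group group_free_group free_group_finite_generating_set hom surj inj]) simp
qed

end
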